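(* For each integer $t\ge 1$ let $L_{\mathrm a}(t)$ be the number of $3\times 3$ magilatin squares with magic sum $t$. Then $\sum_{t>0} L_{\mathrm a}(t)\,x^t$ equals $$\frac{12x^6\,C(x)}{(1+x)(1+x+x^2)(1+x^2)(1-x^3)(1-x^5)(1-x^6)(1-x^7)(1-x^8)},$$ where $$\begin{aligned}C(x)={}&1+3x+7x^2+15x^3+33x^4+65x^5+128x^6+208x^7+316x^8+434x^9+566x^{10}+676x^{11}\\&+784x^{12}+852x^{13}+911x^{14}+936x^{15}+967x^{16}+967x^{17}+1001x^{18}+995x^{19}+1000x^{20}\\&+955x^{21}+893x^{22}+752x^{23}+624x^{24}+456x^{25}+322x^{26}+174x^{27}+79x^{28}.\end{aligned}$$ Moreover, for every integer $t\ge1$, $$L_{\mathrm a}(t)=\tfrac18t^4-3t^3+a_2(t)\,t^2-a_1(t)\,t+a_0(t)-72\,S_7(t),$$ where $S_7(t)=\left\lfloor\frac{t-1}{21}\right\rfloor+\epsilon(t)$ with $\epsilon(t)=1$ if $t\equiv 10,13,16,17,19,20\pmod{21}$ and $\epsilon(t)=0$ otherwise; $a_2(t)=\frac{151}{4}$ if $t\equiv0$; $\frac{135}{4}$ if $t\equiv2,4$; $\frac{63}{2}$ if $t\equiv1,5$; $\frac{71}{2}$ if $t\equiv3\pmod6$; $a_1(t)=\frac{1296}{5}$ if $t\equiv0$; $\frac{1347}{10}$ if $t\equiv1,5$; $\frac{831}{5}$ if $t\equiv2,10$; $\frac{2097}{10}$ if $t\equiv3$; $\frac{876}{5}$ if $t\equiv4,8$;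 $\frac{1251}{5}$ if $t\equiv6$; $\frac{1257}{10}$ if $t\equiv7,11$; $\frac{2187}{10}$ if $t\equiv9\pmod{12}$; and $a_0(t)$ depends only on $t$ modulo $120$ and is given as follows, where in the line for $r$ the six numbers are the values of $a_0$ at $t\equiv r,\ r+20,\ r+40,\ r+60,\ r+80,\ r+100\pmod{120}$, in this order: $r=0$: $876,\ 340,\ 400,\ 840,\ 376,\ 364$; $r=1$: $\frac{4243}{40},\ \frac{21843}{40},\ \frac{3283}{40},\ \frac{5683}{40},\ \frac{20403}{40},\ \frac{4723}{40}$; $r=2$: $\frac{1097}{5},\ \frac{1037}{5},\ \frac{3597}{5},\ \frac{917}{5},\ \frac{1217}{5},\ \frac{3417}{5}$; $r=3$: $\frac{15219}{40},\ \frac{-461}{40},\ \frac{-941}{40},\ \frac{16659}{40},\ \frac{-1901}{40},\ \frac{499}{40}$; $r=4$: $\frac{1604}{5},\ \frac{4164}{5},\ \frac{1484}{5},\ \frac{1784}{5},\ \frac{3984}{5},\ \frac{1664}{5}$; $r=5$: $\frac{1463}{8},\ \frac{1367}{8},\ \frac{4887}{8},\ \frac{1175}{8},\ \frac{1655}{8},\ \frac{4599}{8}$; $r=6$: $\frac{3201}{5},\ \frac{881}{5},\ \frac{821}{5},\ \frac{3381}{5},\ \frac{701}{5},\ \frac{1001}{5}$; $r=7$: $\frac{3091}{40},\ \frac{17811}{40},\ \frac{2131}{40},\ \frac{1651}{40},\ \frac{19251}{40},\ \frac{691}{40}$; $r=8$: $\frac{1448}{5},\ \frac{1388}{5},\ \frac{3948}{5},\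 \frac{1268}{5},\ \frac{1568}{5},\ \frac{3768}{5}$; $r=9$: $\frac{21267}{40},\ \frac{5587}{40},\ \frac{5107}{40},\ \frac{22707}{40},\ \frac{4147}{40},\ \frac{6547}{40}$; $r=10$: $265,\ 705,\ 241,\ 229,\ 741,\ 205$; $r=11$: $\frac{-1037}{40},\ \frac{1363}{40},\ \frac{16083}{40},\ \frac{403}{40},\ \frac{-77}{40},\ \frac{17523}{40}$; $r=12$: $\frac{4092}{5},\ \frac{1772}{5},\ \frac{1712}{5},\ \frac{4272}{5},\ \frac{1592}{5},\ \frac{1892}{5}$; $r=13$: $\frac{4819}{40},\ \frac{19539}{40},\ \frac{3859}{40},\ \frac{3379}{40},\ \frac{20979}{40},\ \frac{2419}{40}$; $r=14$: $\frac{809}{5},\ \frac{1109}{5},\ \frac{3309}{5},\ \frac{989}{5},\ \frac{929}{5},\ \frac{3489}{5}$; $r=15$: $\frac{4023}{8},\ \frac{311}{8},\ \frac{791}{8},\ \frac{3735}{8},\ \frac{599}{8},\ \frac{503}{8}$; $r=16$: $\frac{1676}{5},\ \frac{3876}{5},\ \frac{1556}{5},\ \frac{1496}{5},\ \frac{4056}{5},\ \frac{1376}{5}$; $r=17$: $\frac{5011}{40},\ \frac{7411}{40},\ \frac{22131}{40},\ \frac{6451}{40},\ \frac{5971}{40},\ \frac{23571}{40}$; $r=18$: $\frac{3273}{5},\ \frac{593}{5},\ \frac{893}{5},\ \frac{3093}{5},\ \frac{773}{5},\ \frac{713}{5}$; $r=19$: $\frac{787}{40},\ \frac{18387}{40},\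 \frac{-173}{40},\ \frac{2227}{40},\ \frac{16947}{40},\ \frac{1267}{40}$. The quasipolynomial $L_{\mathrm a}$ has period exactly $840$, and its principal constituent is $\frac18t^4-3t^3+\frac{151}{4}t^2-\frac{9192}{35}t+948$.
   Context: A $3\times3$ magilatin square is a $3\times 3$ matrix of positive integers in which all three row sums and all three column sums are equal (the common value is the magic sum), and in which the three entries of each row are pairwise distinct and the three entries of each column are pairwise distinct (entries in different rows and different columns may be equal). Squares are counted as matrices (not up to symmetry). A function $N$ of $t\in\mathbb Z_{>0}$ is a quasipolynomial if there are a positive integer $p$ and polynomials $N_0,\dots,N_{p-1}$ (the constituents) with $N(t)=N_{t \bmod p}(t)$; the minimal such $p$ is the period, and $N_0$ is the principal constituent. *)

theory Defs
  imports "HOL-Analysis.Analysis" "HOL-Computational_Algebra.Polynomial_FPS"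
begin

definition magilatin_square :: "nat \<Rightarrow> nat ^ 3 ^ 3 \<Rightarrow> bool" where
  "magilatin_square t A \<longleftrightarrow>
     (\<forall>i j. 0 < A $ i $ j) \<and>
     (\<forall>i. (\<Sum>j\<in>UNIV. A $ i $ j) = t) \<and>
     (\<forall>j. (\<Sum>i\<in>UNIV. A $ i $ j) = t) \<and>
     (\<forall>i. inj (\<lambda>j. A $ i $ j)) \<and>
     (\<forall>j. inj (\<lambda>i. A $ i $ j))"

text \<open>The set counted below is finite, since all entries lie between 1 and \<open>t\<close>.\<close>

definition L_a :: "nat \<Rightarrow> nat" where
  "L_a t = card {A. magilatin_square t A}"

text \<open>Quasipolynomials are functions of a positive integer, so the value at 0 of
  \<open>N\<close> is irrelevant.\<close>

definition has_constituents :: "(nat \<Rightarrow> real) \<Rightarrow> nat \<Rightarrow> (nat \<Rightarrow> real poly) \<Rightarrow> bool" where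
  "has_constituents N p c \<longleftrightarrow> p > 0 \<and> (\<forall>t>0. N t = poly (c (t mod p)) (real t))"

definition quasipolynomial :: "(nat \<Rightarrow> real) \<Rightarrow> bool" where
  "quasipolynomial N \<longleftrightarrow> (\<exists>p c. has_constituents N p c)"

text \<open>The next two notions are meaningful only for a quasipolynomial \<open>N\<close>.\<close>

definition quasi_period :: "(nat \<Rightarrow> real) \<Rightarrow> nat" where
  "quasi_period N = (LEAST p. \<exists>c. has_constituents N p c)"

definition principal_constituent :: "(nat \<Rightarrow> real) \<Rightarrow> real poly" where
  "principal_constituent N =
     (THE q. \<exists>c. has_constituents N (quasi_period N) c \<and> q = c 0)"

definition C_poly :: "real poly" where
  "C_poly =
     [:1, 3, 7, 15, 33, 65, 128, 208, 316, 434, 566, 676,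
       784, 852, 911, 936, 967, 967, 1001, 995, 1000,
       955, 893, 752, 624, 456, 322, 174, 79:]"

definition eps :: "nat \<Rightarrow> int" where
  "eps t = (if t mod 21 \<in> {10, 13, 16, 17, 19, 20} then 1 else 0)"

definition S7 :: "nat \<Rightarrow> int" where
  "S7 t = \<lfloor>(real t - 1) / 21\<rfloor> + eps t"

definition a2 :: "nat \<Rightarrow> real" where
  "a2 t =
     (if t mod 6 = 0 then 151/4
      else if t mod 6 \<in> {2, 4} then 135/4
      else if t mod 6 \<in> {1, 5} then 63/2
      else 71/2)"

definition a1 :: "nat \<Rightarrow> real" where
  "a1 t =
     (if t mod 12 = 0 then 1296/5
      else if t mod 12 \<in> {1, 5} then 1347/10
      else if t mod 12 \<in> {2, 10} then 831/5
      else if t mod 12 = 3 then 2097/10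
      else if t mod 12 \<in> {4, 8} then 876/5
      else if t mod 12 = 6 then 1251/5
      else if t mod 12 \<in> {7, 11} then 1257/10
      else 2187/10)"

text \<open>Row \<open>r\<close> and column \<open>k\<close> (both counted from 0) give the value of \<open>a0\<close> on the
  residue class of \<open>r + 20 * k\<close> modulo 120.\<close>

definition a0_table :: "real list list" where
  "a0_table =
    [[876, 340, 400, 840, 376, 364],
     [4243/40, 21843/40, 3283/40, 5683/40, 20403/40, 4723/40],
     [1097/5, 1037/5, 3597/5, 917/5, 1217/5, 3417/5],
     [15219/40, -461/40, -941/40, 16659/40, -1901/40, 499/40],
     [1604/5, 4164/5, 1484/5, 1784/5, 3984/5, 1664/5],
     [1463/8, 1367/8, 4887/8, 1175/8, 1655/8, 4599/8],
     [3201/5, 881/5, 821/5, 3381/5, 701/5, 1001/5],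
     [3091/40, 17811/40, 2131/40, 1651/40, 19251/40, 691/40],
     [1448/5, 1388/5, 3948/5, 1268/5, 1568/5, 3768/5],
     [21267/40, 5587/40, 5107/40, 22707/40, 4147/40, 6547/40],
     [265, 705, 241, 229, 741, 205],
     [-1037/40, 1363/40, 16083/40, 403/40, -77/40, 17523/40],
     [4092/5, 1772/5, 1712/5, 4272/5, 1592/5, 1892/5],
     [4819/40, 19539/40, 3859/40, 3379/40, 20979/40, 2419/40],
     [809/5, 1109/5, 3309/5, 989/5, 929/5, 3489/5],
     [4023/8, 311/8, 791/8, 3735/8, 599/8, 503/8],
     [1676/5, 3876/5, 1556/5, 1496/5, 4056/5, 1376/5],
     [5011/40, 7411/40, 22131/40, 6451/40, 5971/40, 23571/40],
     [3273/5, 593/5, 893/5, 3093/5, 773/5, 713/5],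
     [787/40, 18387/40, -173/40, 2227/40, 16947/40, 1267/40]]"

definition a0 :: "nat \<Rightarrow> real" where
  "a0 t = a0_table ! (t mod 20) ! (t mod 120 div 20)"

end

theory Submission
  imports Defs
begin

text \<open>
  Every cell of a 3 by 3 matrix lies in exactly one even and one odd permutation matrix. Hence a square
  with equal line sums has entries \<open>a\<^sub>k + b\<^sub>l\<close>, one for each pair of indices, and its lines are the six
  transversals of the addition table of \<open>a\<close> and \<open>b\<close>. Such a square is magilatin iff no distance between
  two entries of \<open>a\<close> equals a distance between two entries of \<open>b\<close>. Normalizing the sorted triples to
  \<open>0, p, p + q\<close> and \<open>0, r, r + s\<close> and writing the least entry of the square as \<open>x\<close>, the magic sum is
  \<open>3x + 2p + q + 2r + s\<close> and the condition says that \<open>{p, q, p + q}\<close> and \<open>{r, s, r + s}\<close> are disjoint.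
  Inclusion-exclusion over the possible coincidences expresses the generating function as a signed sum of
  generating functions of simplicial cones, that is, of products of series \<open>X\<^sup>k / (1 - X\<^sup>k)\<close>.

  The closed form follows since its generating function is rational as well: the differences with steps
  12, 12, 12, 21 and 120 annihilate it. The period is exactly 840 since the constituent of no other
  residue class coincides with that of 0.
\<close>

section \<open>Generating functions of weighted sets\<close>

text \<open>The weights \<open>m\<close> are real so that signed inclusion-exclusion sums stay
  within the notion. The sum over an infinite fibre of \<open>w\<close> is 0 by convention, so the
  coefficients are true counts only when the fibres are finite.\<close>

definition weighted_gf :: "'a set \<Rightarrow> ('a \<Rightarrow> nat) \<Rightarrow> ('a \<Rightarrow> real) \<Rightarrow> real fps" where
  "weighted_gf A w m = Abs_fps (\<lambda>n. \<Sum>a \<in> {a \<in> A. w a = n}. m a)"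

lemma weighted_gf_add: "weighted_gf A w (\<lambda>a. m a + m' a) = weighted_gf A w m + weighted_gf A w m'"
  by (simp add: weighted_gf_def fps_eq_iff sum.distrib)

lemma weighted_gf_diff: "weighted_gf A w (\<lambda>a. m a - m' a) = weighted_gf A w m - weighted_gf A w m'"
  by (simp add: weighted_gf_def fps_eq_iff sum_subtractf)

lemma weighted_gf_scale: "weighted_gf A w (\<lambda>a. c * m a) = fps_const c * weighted_gf A w m"
  by (simp add: weighted_gf_def fps_eq_iff sum_distrib_left)

text \<open>Sorting the pairs of weight \<open>n\<close> by the weight \<open>i\<close> of their
  first component gives the Cauchy product.\<close>

lemma weighted_gf_product:
  assumes "\<And>n. finite {a \<in> A. w a = n}" "\<And>n. finite {b \<in> B. v b = n}"
  shows "weighted_gf (A \<times> B) (\<lambda>(a, b). w a + v b) (\<lambda>(a, b). m a * k b) = weighted_gf A w m * weighted_gf B v k"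
proof -
  have "(\<Sum>z | z \<in> A \<times> B \<and> (case z of (a, b) \<Rightarrow> w a + v b) = n. case z of (a, b) \<Rightarrow> m a * k b)
      = (\<Sum>i = 0..n. (\<Sum>a | a \<in> A \<and> w a = i. m a) * (\<Sum>b | b \<in> B \<and> v b = n - i. k b))"
    (is "?l = ?r") for n
  proof -
    have "?r = (\<Sum>i = 0..n. \<Sum>(a, b) \<in> {a \<in> A. w a = i} \<times> {b \<in> B. v b = n - i}. m a * k b)"
      by (simp add: sum_product sum.cartesian_product)
    also have "\<dots> = (\<Sum>(i, a, b) \<in> (SIGMA i:{0..n}. {a \<in> A. w a = i} \<times> {b \<in> B. v b = n - i}). m a * k b)"
      by (subst sum.Sigma) (use assms in auto)
    also have "\<dots> = ?l"
      by (rule sum.reindex_bij_witness[of _ "\<lambda>(a, b). (w a, a, b)" snd]) auto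
    finally show ?thesis ..
  qed
  then show ?thesis
    by (simp add: weighted_gf_def fps_eq_iff fps_mult_nth)
qed

lemma weighted_gf_reindex:
  assumes "\<And>b. b \<in> B \<Longrightarrow> f b \<in> A" "\<And>a. a \<in> A \<Longrightarrow> g a \<in> B"
    and "\<And>b. b \<in> B \<Longrightarrow> g (f b) = b" "\<And>a. a \<in> A \<Longrightarrow> f (g a) = a"
    and "\<And>b. b \<in> B \<Longrightarrow> w (f b) = v b" "\<And>b. b \<in> B \<Longrightarrow> m (f b) = k b"
  shows "weighted_gf A w m = weighted_gf B v k"
proof -
  have "(\<Sum>a | a \<in> A \<and> w a = n. m a) = (\<Sum>b | b \<in> B \<and> v b = n. k b)" for n
    by (rule sum.reindex_bij_witness[of _ f g]) (use assms in \<open>auto, metis+\<close>)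
  then show ?thesis
    by (simp add: weighted_gf_def fps_eq_iff)
qed

lemma weighted_gf_of_bool:
  assumes "\<And>n. finite {a \<in> A. w a = n}"
  shows "weighted_gf A w (\<lambda>a. of_bool (P a)) = weighted_gf {a \<in> A. P a} w (\<lambda>_. 1)"
proof -
  have "(\<Sum>a | a \<in> A \<and> w a = n. of_bool (P a)) = (\<Sum>a | (a \<in> A \<and> P a) \<and> w a = n. 1 :: real)" for n
    by (rule sum.mono_neutral_cong_right) (use assms[of n] in auto)
  then show ?thesis
    by (simp add: weighted_gf_def)
qed

section \<open>Rays and open simplicial cones\<close>

definition ray :: "nat \<Rightarrow> real fps" where
  "ray k = weighted_gf {0<..} (\<lambda>a. k * a) (\<lambda>_. 1)"

lemma finite_ray: "0 < k \<Longrightarrow> finite {a \<in> {0<..}. k * a = n}" for k n :: nat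
  by (rule finite_subset[of _ "{..n}"]) auto

lemma ray_nth: "0 < k \<Longrightarrow> fps_nth (ray k) n = of_bool (0 < n \<and> k dvd n)"
proof -
  assume k: "0 < k"
  have "{a \<in> {0<..}. k * a = n} = (if 0 < n \<and> k dvd n then {n div k} else {})"
    using k by (auto elim!: dvdE)
  then show ?thesis
    by (simp add: ray_def weighted_gf_def)
qed

text \<open>This identifies \<open>ray k\<close> with \<open>X^k / (1 - X^k)\<close>. Subtracting
  the shift by \<open>k\<close> cancels the coefficients at all multiples of \<open>k\<close> except
  \<open>k\<close> itself, since a ray omits its apex 0.\<close>

lemma ray_mult: 
  assumes "0 < k"
  shows "(1 - fps_X ^ k) * ray k = fps_X ^ k"
proof (rule fps_ext)
  fix n
  have "k dvd n - k \<longleftrightarrow> k dvd n" if "k \<le> n"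
    using that by (simp add: dvd_diff_nat dvd_minus_self)
  moreover have "\<not> k dvd n" if "0 < n" "n < k"
    using that by (simp add: nat_dvd_not_less)
  ultimately show "fps_nth ((1 - fps_X ^ k) * ray k) n = fps_nth (fps_X ^ k) n"
    using assms by (auto simp: left_diff_distrib fps_X_power_mult_nth ray_nth fps_X_power_nth)
qed

lemma finite_cone2:
  assumes "0 < i" "0 < j"
  shows "finite {z \<in> {0<..} \<times> {0<..}. (case z of (a, b) \<Rightarrow> i * a + j * b) = (n :: nat)}"
proof (rule finite_subset)
  show "{z \<in> {0<..} \<times> {0<..}. (case z of (a, b) \<Rightarrow> i * a + j * b) = n} \<subseteq> {..n} \<times> {..n}"
    using assms by (auto intro: order.trans[OF _ le_add1] order.trans[OF _ le_add2])
qed auto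

lemma weighted_gf_cone2:
  assumes "0 < i" "0 < j"
  shows "weighted_gf ({0<..} \<times> {0<..}) (\<lambda>(a, b). i * a + j * b) (\<lambda>_. 1) = ray i * ray j"
  using weighted_gf_product[OF finite_ray finite_ray, of i j "\<lambda>_. 1" "\<lambda>_. 1"] assms
  by (simp add: ray_def case_prod_unfold)

lemma weighted_gf_cone3:
  assumes "0 < i" "0 < j" "0 < k"
  shows "weighted_gf ({0<..} \<times> {0<..} \<times> {0<..}) (\<lambda>(a, b, c). i * a + j * b + k * c) (\<lambda>_. 1)
    = ray i * ray j * ray k"
  using weighted_gf_product[OF finite_ray finite_cone2, of i j k "\<lambda>_. 1" "\<lambda>_. 1"] weighted_gf_cone2[of j k] assms
  by (simp add: ray_def case_prod_unfold add.assoc mult.assoc)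

lemma weighted_gf_cone4:
  assumes "0 < i" "0 < j" "0 < k" "0 < l"
  shows "weighted_gf ({0<..} \<times> {0<..} \<times> {0<..} \<times> {0<..}) (\<lambda>(a, b, c, d). i * a + j * b + k * c + l * d) (\<lambda>_. 1)
    = ray i * ray j * ray k * ray l"
proof -
  have "weighted_gf (({0<..} \<times> {0<..}) \<times> ({0<..} \<times> {0<..}))
      (\<lambda>(y, z). (case y of (a, b) \<Rightarrow> i * a + j * b) + (case z of (c, d) \<Rightarrow> k * c + l * d)) (\<lambda>(y, z). 1 * 1)
    = (ray i * ray j) * (ray k * ray l)"
    using assms by (simp only: weighted_gf_product[OF finite_cone2 finite_cone2] weighted_gf_cone2)
  also have "weighted_gf (({0<..} \<times> {0<..}) \<times> ({0<..} \<times> {0<..}))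
      (\<lambda>(y, z). (case y of (a, b) \<Rightarrow> i * a + j * b) + (case z of (c, d) \<Rightarrow> k * c + l * d)) (\<lambda>(y, z). 1 * 1)
    = weighted_gf ({0<..} \<times> {0<..} \<times> {0<..} \<times> {0<..}) (\<lambda>(a, b, c, d). i * a + j * b + k * c + l * d) (\<lambda>_. 1 :: real)"
    by (rule weighted_gf_reindex[where f = "\<lambda>(a, b, c, d). ((a, b), c, d)" and g = "\<lambda>((a, b), c, d). (a, b, c, d)"])
      auto
  finally show ?thesis
    by (simp add: mult.assoc)
qed

text \<open>A tuple \<open>(p, q, r, s)\<close> stands for the sorted triples \<open>(0, p, p + q)\<close> and \<open>(0, r, r + s)\<close>;
  its weight is the sum of all their entries.\<close>

type_synonym gaps = "nat \<times> nat \<times> nat \<times> nat"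

fun gap_weight :: "gaps \<Rightarrow> nat" where
  "gap_weight (p, q, r, s) = 2 * p + q + (2 * r + s)"

definition gap_gf :: "(gaps \<Rightarrow> real) \<Rightarrow> real fps" where
  "gap_gf = weighted_gf UNIV gap_weight"

lemma finite_gaps: "finite {z \<in> UNIV. gap_weight z = n}"
  by (rule finite_subset[of _ "{..n} \<times> {..n} \<times> {..n} \<times> {..n}"]) auto

lemmas gap_gf_linear = weighted_gf_add[where A = UNIV and w = gap_weight, folded gap_gf_def]
  weighted_gf_diff[where A = UNIV and w = gap_weight, folded gap_gf_def]
  weighted_gf_scale[where A = UNIV and w = gap_weight, folded gap_gf_def]

lemma gap_gf_reindex:
  assumes "\<And>b. b \<in> B \<Longrightarrow> P (f b)" "\<And>a. P a \<Longrightarrow> g a \<in> B"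
    and "\<And>b. b \<in> B \<Longrightarrow> g (f b) = b" "\<And>a. P a \<Longrightarrow> f (g a) = a"
    and "\<And>b. b \<in> B \<Longrightarrow> gap_weight (f b) = v b"
  shows "gap_gf (\<lambda>z. of_bool (P z)) = weighted_gf B v (\<lambda>_. 1)"
  unfolding gap_gf_def weighted_gf_of_bool[OF finite_gaps]
  by (rule weighted_gf_reindex[where f = f and g = g]) (use assms in auto)

lemma gap_gf_swap: "gap_gf (\<lambda>(p, q, r, s). m (r, s, p, q)) = gap_gf m"
  unfolding gap_gf_def
  by (rule weighted_gf_reindex[where f = "\<lambda>(p, q, r, s). (r, s, p, q)" and g = "\<lambda>(p, q, r, s). (r, s, p, q)"]) auto

section \<open>Inclusion-exclusion over coincident distances\<close>

text \<open>In this lemma and the next two, \<open>f\<close> parametrizes the region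
  \<open>P\<close> by positive coefficients on the generators of a simplicial cone, \<open>g\<close>
  reads these coefficients off, and \<open>i\<close>, \<open>j\<close>, \<open>k\<close> are the
  weights of the generators.\<close>

lemma gap_gf_cone1:
  assumes "0 < i"
    and "\<And>a. 0 < a \<Longrightarrow> P (f a)" "\<And>z. P z \<Longrightarrow> 0 < g z"
    and "\<And>a. 0 < a \<Longrightarrow> g (f a) = a" "\<And>z. P z \<Longrightarrow> f (g z) = z"
    and "\<And>a. 0 < a \<Longrightarrow> gap_weight (f a) = i * a"
  shows "gap_gf (\<lambda>z. of_bool (P z)) = ray i"
  unfolding ray_def by (rule gap_gf_reindex[of _ _ f g]) (use assms in auto)

lemma gap_gf_cone2:
  assumes "0 < i" "0 < j"
    and "\<And>a b. 0 < a \<Longrightarrow> 0 < b \<Longrightarrow> P (f (a, b))" "\<And>z. P z \<Longrightarrow> g z \<in> {0<..} \<times> {0<..}"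
    and "\<And>a b. 0 < a \<Longrightarrow> 0 < b \<Longrightarrow> g (f (a, b)) = (a, b)" "\<And>z. P z \<Longrightarrow> f (g z) = z"
    and "\<And>a b. 0 < a \<Longrightarrow> 0 < b \<Longrightarrow> gap_weight (f (a, b)) = i * a + j * b"
  shows "gap_gf (\<lambda>z. of_bool (P z)) = ray i * ray j"
  unfolding weighted_gf_cone2[OF assms(1,2), symmetric]
  by (rule gap_gf_reindex[of _ _ f g]) (use assms in auto)

lemma gap_gf_cone3:
  assumes "0 < i" "0 < j" "0 < k"
    and "\<And>a b c. 0 < a \<Longrightarrow> 0 < b \<Longrightarrow> 0 < c \<Longrightarrow> P (f (a, b, c))"
    and "\<And>z. P z \<Longrightarrow> g z \<in> {0<..} \<times> {0<..} \<times> {0<..}"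
    and "\<And>a b c. 0 < a \<Longrightarrow> 0 < b \<Longrightarrow> 0 < c \<Longrightarrow> g (f (a, b, c)) = (a, b, c)"
    and "\<And>z. P z \<Longrightarrow> f (g z) = z"
    and "\<And>a b c. 0 < a \<Longrightarrow> 0 < b \<Longrightarrow> 0 < c \<Longrightarrow> gap_weight (f (a, b, c)) = i * a + j * b + k * c"
  shows "gap_gf (\<lambda>z. of_bool (P z)) = ray i * ray j * ray k"
  unfolding weighted_gf_cone3[OF assms(1-3), symmetric]
  by (rule gap_gf_reindex[of _ _ f g]) (use assms in auto)

section \<open>Coincidences between triples with distinct entries\<close>

fun separated :: "gaps \<Rightarrow> bool" where
  "separated (p, q, r, s) \<longleftrightarrow> {p, q, p + q} \<inter> {r, s, r + s} = {}"

fun positive :: "gaps \<Rightarrow> bool" where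
  "positive (p, q, r, s) \<longleftrightarrow> 0 < p \<and> 0 < q \<and> 0 < r \<and> 0 < s"

lemma gap_gf_positive: "gap_gf (\<lambda>z. of_bool (positive z)) = ray 2 * ray 1 * ray 2 * ray 1"
proof -
  have "gap_gf (\<lambda>z. of_bool (positive z)) = weighted_gf ({0<..} \<times> {0<..} \<times> {0<..} \<times> {0<..})
      (\<lambda>(a, b, c, d). 2 * a + 1 * b + 2 * c + 1 * d) (\<lambda>_. 1)"
    by (rule gap_gf_reindex[of _ _ id id]) auto
  then show ?thesis by (simp only: weighted_gf_cone4)
qed

text \<open>Comparing \<open>p\<close> with \<open>r\<close> cuts the region into two open cones of
  dimension 3 and their common face \<open>p = r\<close>, on which \<open>s = q\<close>.\<close>

lemma gap_gf_equal_spread: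
  "gap_gf (\<lambda>z. of_bool (case z of (p, q, r, s) \<Rightarrow> 0 < p \<and> 0 < q \<and> 0 < r \<and> 0 < s \<and> p + q = r + s)) =
     ray 4 * ray 3 * ray 2
     + ray 4 * ray 3 * ray 2
     + ray 4 * ray 2"
    (is "gap_gf (\<lambda>z. of_bool (?P z)) = _")
proof -
  have "gap_gf (\<lambda>z. of_bool (?P z)) = gap_gf (\<lambda>z.
       of_bool (case z of (p, q, r, s) \<Rightarrow> 0 < p \<and> p < r \<and> 0 < s \<and> p + q = r + s)
       + of_bool (case z of (p, q, r, s) \<Rightarrow> 0 < r \<and> r < p \<and> 0 < q \<and> p + q = r + s)
       + of_bool (case z of (p, q, r, s) \<Rightarrow> 0 < p \<and> 0 < q \<and> r = p \<and> s = q))"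
    (is "_ = gap_gf ?sum")
  proof (rule arg_cong[where f = gap_gf], rule ext)
    fix z :: gaps
    obtain p q r s where z: "z = (p, q, r, s)" by (cases z)
    show "of_bool (?P z) = ?sum z"
      unfolding z prod.case
      by (cases p r rule: linorder_cases; auto)
  qed
  also have "\<dots> = gap_gf (\<lambda>z. of_bool (case z of (p, q, r, s) \<Rightarrow> 0 < p \<and> p < r \<and> 0 < s \<and> p + q = r + s))
      + gap_gf (\<lambda>z. of_bool (case z of (p, q, r, s) \<Rightarrow> 0 < r \<and> r < p \<and> 0 < q \<and> p + q = r + s))
      + gap_gf (\<lambda>z. of_bool (case z of (p, q, r, s) \<Rightarrow> 0 < p \<and> 0 < q \<and> r = p \<and> s = q))"
    unfolding gap_gf_linear
    by (rule refl)
  also have "gap_gf (\<lambda>z. of_bool (case z of (p, q, r, s) \<Rightarrow> 0 < p \<and> p < r \<and> 0 < s \<and> p + q = r + s)) = ray 4 * ray 3 * ray 2"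
    by (rule gap_gf_cone3[where f = "\<lambda>(a, b, c). (a, b + c, a + b, c)" and g = "\<lambda>(p, q, r, s). (p, r - p, s)"]) auto
  also have "gap_gf (\<lambda>z. of_bool (case z of (p, q, r, s) \<Rightarrow> 0 < r \<and> r < p \<and> 0 < q \<and> p + q = r + s)) = ray 4 * ray 3 * ray 2"
    by (rule gap_gf_cone3[where f = "\<lambda>(a, b, c). (a + b, c, a, b + c)" and g = "\<lambda>(p, q, r, s). (r, p - r, q)"]) auto
  also have "gap_gf (\<lambda>z. of_bool (case z of (p, q, r, s) \<Rightarrow> 0 < p \<and> 0 < q \<and> r = p \<and> s = q)) = ray 4 * ray 2"
    by (rule gap_gf_cone2[where f = "\<lambda>(a, b). (a, b, a, b)" and g = "\<lambda>(p, q, r, s). (p, q)"]) auto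
  finally show ?thesis .
qed

text \<open>For positive \<open>p\<close> and \<open>q\<close> the cases \<open>r = p\<close> and
  \<open>r = q\<close> overlap only where \<open>p = q\<close>, and \<open>r = p + q\<close>
  excludes both. In the three cases the inequality of the spreads reduces to \<open>q < s\<close>,
  \<open>p < s\<close> and \<open>0 < s\<close>.\<close>

lemma gap_gf_r_coincides:
  "gap_gf (\<lambda>z. of_bool (case z of (p, q, r, s) \<Rightarrow> 0 < p \<and> 0 < q \<and> 0 < r \<and> 0 < s \<and> p + q < r + s \<and> r \<in> {p, q, p + q})) =
     ray 4 * ray 2 * ray 1
     + ray 3 * ray 3 * ray 1
     - ray 6 * ray 1
     + ray 4 * ray 3 * ray 1"
    (is "gap_gf (\<lambda>z. of_bool (?P z)) = _")
proof -
  have "gap_gf (\<lambda>z. of_bool (?P z)) = gap_gf (\<lambda>z.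
       of_bool (case z of (p, q, r, s) \<Rightarrow> 0 < p \<and> 0 < q \<and> r = p \<and> q < s)
       + of_bool (case z of (p, q, r, s) \<Rightarrow> 0 < p \<and> 0 < q \<and> r = q \<and> p < s)
       - of_bool (case z of (p, q, r, s) \<Rightarrow> 0 < p \<and> q = p \<and> r = p \<and> p < s)
       + of_bool (case z of (p, q, r, s) \<Rightarrow> 0 < p \<and> 0 < q \<and> r = p + q \<and> 0 < s))"
    (is "_ = gap_gf ?sum")
  proof (rule arg_cong[where f = gap_gf], rule ext)
    fix z :: gaps
    obtain p q r s where z: "z = (p, q, r, s)" by (cases z)
    show "of_bool (?P z) = ?sum z"
      unfolding z prod.case
      by (cases "r = p"; cases "r = q"; cases "r = p + q"; auto)
  qed
  also have "\<dots> = gap_gf (\<lambda>z. of_bool (case z of (p, q, r, s) \<Rightarrow> 0 < p \<and> 0 < q \<and> r = p \<and> q < s))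
      + gap_gf (\<lambda>z. of_bool (case z of (p, q, r, s) \<Rightarrow> 0 < p \<and> 0 < q \<and> r = q \<and> p < s))
      - gap_gf (\<lambda>z. of_bool (case z of (p, q, r, s) \<Rightarrow> 0 < p \<and> q = p \<and> r = p \<and> p < s))
      + gap_gf (\<lambda>z. of_bool (case z of (p, q, r, s) \<Rightarrow> 0 < p \<and> 0 < q \<and> r = p + q \<and> 0 < s))"
    unfolding gap_gf_linear
    by (rule refl)
  also have "gap_gf (\<lambda>z. of_bool (case z of (p, q, r, s) \<Rightarrow> 0 < p \<and> 0 < q \<and> r = p \<and> q < s)) = ray 4 * ray 2 * ray 1"
    by (rule gap_gf_cone3[where f = "\<lambda>(a, b, c). (a, b, a, b + c)" and g = "\<lambda>(p, q, r, s). (p, q, s - q)"]) auto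
  also have "gap_gf (\<lambda>z. of_bool (case z of (p, q, r, s) \<Rightarrow> 0 < p \<and> 0 < q \<and> r = q \<and> p < s)) = ray 3 * ray 3 * ray 1"
    by (rule gap_gf_cone3[where f = "\<lambda>(a, b, c). (a, b, b, a + c)" and g = "\<lambda>(p, q, r, s). (p, q, s - p)"]) auto
  also have "gap_gf (\<lambda>z. of_bool (case z of (p, q, r, s) \<Rightarrow> 0 < p \<and> q = p \<and> r = p \<and> p < s)) = ray 6 * ray 1"
    by (rule gap_gf_cone2[where f = "\<lambda>(a, b). (a, a, a, a + b)" and g = "\<lambda>(p, q, r, s). (p, s - p)"]) auto
  also have "gap_gf (\<lambda>z. of_bool (case z of (p, q, r, s) \<Rightarrow> 0 < p \<and> 0 < q \<and> r = p + q \<and> 0 < s)) = ray 4 * ray 3 * ray 1"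
    by (rule gap_gf_cone3[where f = "\<lambda>(a, b, c). (a, b, a + b, c)" and g = "\<lambda>(p, q, r, s). (p, q, s)"]) auto
  finally show ?thesis .
qed

text \<open>The case distinction is the one for \<open>r\<close>, but the cones have other weights
  because \<open>gap_weight\<close> counts \<open>r\<close> twice and \<open>s\<close> once.\<close>

lemma gap_gf_s_coincides:
  "gap_gf (\<lambda>z. of_bool (case z of (p, q, r, s) \<Rightarrow> 0 < p \<and> 0 < q \<and> 0 < r \<and> 0 < s \<and> p + q < r + s \<and> s \<in> {p, q, p + q})) =
     ray 3 * ray 3 * ray 2
     + ray 4 * ray 2 * ray 2
     - ray 6 * ray 2
     + ray 3 * ray 2 * ray 2"
    (is "gap_gf (\<lambda>z. of_bool (?P z)) = _")
proof -
  have "gap_gf (\<lambda>z. of_bool (?P z)) = gap_gf (\<lambda>z.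
       of_bool (case z of (p, q, r, s) \<Rightarrow> 0 < p \<and> 0 < q \<and> s = p \<and> q < r)
       + of_bool (case z of (p, q, r, s) \<Rightarrow> 0 < p \<and> 0 < q \<and> s = q \<and> p < r)
       - of_bool (case z of (p, q, r, s) \<Rightarrow> 0 < p \<and> q = p \<and> s = p \<and> p < r)
       + of_bool (case z of (p, q, r, s) \<Rightarrow> 0 < p \<and> 0 < q \<and> s = p + q \<and> 0 < r))"
    (is "_ = gap_gf ?sum")
  proof (rule arg_cong[where f = gap_gf], rule ext)
    fix z :: gaps
    obtain p q r s where z: "z = (p, q, r, s)" by (cases z)
    show "of_bool (?P z) = ?sum z"
      unfolding z prod.case
      by (cases "s = p"; cases "s = q"; cases "s = p + q"; auto)
  qed
  also have "\<dots> = gap_gf (\<lambda>z. of_bool (case z of (p, q, r, s) \<Rightarrow> 0 < p \<and> 0 < q \<and> s = p \<and> q < r))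
      + gap_gf (\<lambda>z. of_bool (case z of (p, q, r, s) \<Rightarrow> 0 < p \<and> 0 < q \<and> s = q \<and> p < r))
      - gap_gf (\<lambda>z. of_bool (case z of (p, q, r, s) \<Rightarrow> 0 < p \<and> q = p \<and> s = p \<and> p < r))
      + gap_gf (\<lambda>z. of_bool (case z of (p, q, r, s) \<Rightarrow> 0 < p \<and> 0 < q \<and> s = p + q \<and> 0 < r))"
    unfolding gap_gf_linear
    by (rule refl)
  also have "gap_gf (\<lambda>z. of_bool (case z of (p, q, r, s) \<Rightarrow> 0 < p \<and> 0 < q \<and> s = p \<and> q < r)) = ray 3 * ray 3 * ray 2"
    by (rule gap_gf_cone3[where f = "\<lambda>(a, b, c). (a, b, b + c, a)" and g = "\<lambda>(p, q, r, s). (p, q, r - q)"]) auto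
  also have "gap_gf (\<lambda>z. of_bool (case z of (p, q, r, s) \<Rightarrow> 0 < p \<and> 0 < q \<and> s = q \<and> p < r)) = ray 4 * ray 2 * ray 2"
    by (rule gap_gf_cone3[where f = "\<lambda>(a, b, c). (a, b, a + c, b)" and g = "\<lambda>(p, q, r, s). (p, q, r - p)"]) auto
  also have "gap_gf (\<lambda>z. of_bool (case z of (p, q, r, s) \<Rightarrow> 0 < p \<and> q = p \<and> s = p \<and> p < r)) = ray 6 * ray 2"
    by (rule gap_gf_cone2[where f = "\<lambda>(a, b). (a, a, a + b, a)" and g = "\<lambda>(p, q, r, s). (p, r - p)"]) auto
  also have "gap_gf (\<lambda>z. of_bool (case z of (p, q, r, s) \<Rightarrow> 0 < p \<and> 0 < q \<and> s = p + q \<and> 0 < r)) = ray 3 * ray 2 * ray 2"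
    by (rule gap_gf_cone3[where f = "\<lambda>(a, b, c). (a, b, c, a + b)" and g = "\<lambda>(p, q, r, s). (p, q, r)"]) auto
  finally show ?thesis .
qed

text \<open>Of the nine choices for \<open>(r, s)\<close>, the inequality of the spreads rules out
  \<open>(p, q)\<close> and \<open>(q, p)\<close>, and it turns into \<open>q < p\<close> for
  \<open>(p, p)\<close> and into \<open>p < q\<close> for \<open>(q, q)\<close>. The two subtracted
  rays are the overlaps at \<open>p = q\<close> of \<open>(p, p + q)\<close> with
  \<open>(q, p + q)\<close> and of \<open>(p + q, p)\<close> with \<open>(p + q, q)\<close>.\<close>

lemma gap_gf_both_coincide:
  "gap_gf (\<lambda>z. of_bool (case z of (p, q, r, s) \<Rightarrow> 0 < p \<and> 0 < q \<and> 0 < r \<and> 0 < s \<and> p + q < r + s \<and> r \<in> {p, q, p + q} \<and> s \<in> {p, q, p + q})) =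
     ray 5 * ray 6
     + ray 6 * ray 4
     + ray 5 * ray 2
     + ray 3 * ray 4
     - ray 7
     + ray 5 * ray 3
     + ray 4 * ray 4
     - ray 8
     + ray 5 * ray 4"
    (is "gap_gf (\<lambda>z. of_bool (?P z)) = _")
proof -
  have "gap_gf (\<lambda>z. of_bool (?P z)) = gap_gf (\<lambda>z.
       of_bool (case z of (p, q, r, s) \<Rightarrow> 0 < q \<and> q < p \<and> r = p \<and> s = p)
       + of_bool (case z of (p, q, r, s) \<Rightarrow> 0 < p \<and> p < q \<and> r = q \<and> s = q)
       + of_bool (case z of (p, q, r, s) \<Rightarrow> 0 < p \<and> 0 < q \<and> r = p \<and> s = p + q)
       + of_bool (case z of (p, q, r, s) \<Rightarrow> 0 < p \<and> 0 < q \<and> r = q \<and> s = p + q)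
       - of_bool (case z of (p, q, r, s) \<Rightarrow> 0 < p \<and> q = p \<and> r = p \<and> s = 2 * p)
       + of_bool (case z of (p, q, r, s) \<Rightarrow> 0 < p \<and> 0 < q \<and> r = p + q \<and> s = p)
       + of_bool (case z of (p, q, r, s) \<Rightarrow> 0 < p \<and> 0 < q \<and> r = p + q \<and> s = q)
       - of_bool (case z of (p, q, r, s) \<Rightarrow> 0 < p \<and> q = p \<and> r = 2 * p \<and> s = p)
       + of_bool (case z of (p, q, r, s) \<Rightarrow> 0 < p \<and> 0 < q \<and> r = p + q \<and> s = p + q))"
    (is "_ = gap_gf ?sum")
  proof (rule arg_cong[where f = gap_gf], rule ext)
    fix z :: gaps
    obtain p q r s where z: "z = (p, q, r, s)" by (cases z)
    show "of_bool (?P z) = ?sum z"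
      unfolding z prod.case
      by (cases p q rule: linorder_cases; cases "r = p"; cases "r = q"; cases "r = p + q"; cases "s = p"; cases "s = q"; cases "s = p + q"; auto)
  qed
  also have "\<dots> = gap_gf (\<lambda>z. of_bool (case z of (p, q, r, s) \<Rightarrow> 0 < q \<and> q < p \<and> r = p \<and> s = p))
      + gap_gf (\<lambda>z. of_bool (case z of (p, q, r, s) \<Rightarrow> 0 < p \<and> p < q \<and> r = q \<and> s = q))
      + gap_gf (\<lambda>z. of_bool (case z of (p, q, r, s) \<Rightarrow> 0 < p \<and> 0 < q \<and> r = p \<and> s = p + q))
      + gap_gf (\<lambda>z. of_bool (case z of (p, q, r, s) \<Rightarrow> 0 < p \<and> 0 < q \<and> r = q \<and> s = p + q))
      - gap_gf (\<lambda>z. of_bool (case z of (p, q, r, s) \<Rightarrow> 0 < p \<and> q = p \<and> r = p \<and> s = 2 * p))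
      + gap_gf (\<lambda>z. of_bool (case z of (p, q, r, s) \<Rightarrow> 0 < p \<and> 0 < q \<and> r = p + q \<and> s = p))
      + gap_gf (\<lambda>z. of_bool (case z of (p, q, r, s) \<Rightarrow> 0 < p \<and> 0 < q \<and> r = p + q \<and> s = q))
      - gap_gf (\<lambda>z. of_bool (case z of (p, q, r, s) \<Rightarrow> 0 < p \<and> q = p \<and> r = 2 * p \<and> s = p))
      + gap_gf (\<lambda>z. of_bool (case z of (p, q, r, s) \<Rightarrow> 0 < p \<and> 0 < q \<and> r = p + q \<and> s = p + q))"
    unfolding gap_gf_linear
    by (rule refl)
  also have "gap_gf (\<lambda>z. of_bool (case z of (p, q, r, s) \<Rightarrow> 0 < q \<and> q < p \<and> r = p \<and> s = p)) = ray 5 * ray 6"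
    by (rule gap_gf_cone2[where f = "\<lambda>(a, b). (a + b, b, a + b, a + b)" and g = "\<lambda>(p, q, r, s). (p - q, q)"]) auto
  also have "gap_gf (\<lambda>z. of_bool (case z of (p, q, r, s) \<Rightarrow> 0 < p \<and> p < q \<and> r = q \<and> s = q)) = ray 6 * ray 4"
    by (rule gap_gf_cone2[where f = "\<lambda>(a, b). (a, a + b, a + b, a + b)" and g = "\<lambda>(p, q, r, s). (p, q - p)"]) auto
  also have "gap_gf (\<lambda>z. of_bool (case z of (p, q, r, s) \<Rightarrow> 0 < p \<and> 0 < q \<and> r = p \<and> s = p + q)) = ray 5 * ray 2"
    by (rule gap_gf_cone2[where f = "\<lambda>(a, b). (a, b, a, a + b)" and g = "\<lambda>(p, q, r, s). (p, q)"]) auto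
  also have "gap_gf (\<lambda>z. of_bool (case z of (p, q, r, s) \<Rightarrow> 0 < p \<and> 0 < q \<and> r = q \<and> s = p + q)) = ray 3 * ray 4"
    by (rule gap_gf_cone2[where f = "\<lambda>(a, b). (a, b, b, a + b)" and g = "\<lambda>(p, q, r, s). (p, q)"]) auto
  also have "gap_gf (\<lambda>z. of_bool (case z of (p, q, r, s) \<Rightarrow> 0 < p \<and> q = p \<and> r = p \<and> s = 2 * p)) = ray 7"
    by (rule gap_gf_cone1[where f = "\<lambda>a. (a, a, a, 2 * a)" and g = "\<lambda>(p, q, r, s). p"]) auto
  also have "gap_gf (\<lambda>z. of_bool (case z of (p, q, r, s) \<Rightarrow> 0 < p \<and> 0 < q \<and> r = p + q \<and> s = p)) = ray 5 * ray 3"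
    by (rule gap_gf_cone2[where f = "\<lambda>(a, b). (a, b, a + b, a)" and g = "\<lambda>(p, q, r, s). (p, q)"]) auto
  also have "gap_gf (\<lambda>z. of_bool (case z of (p, q, r, s) \<Rightarrow> 0 < p \<and> 0 < q \<and> r = p + q \<and> s = q)) = ray 4 * ray 4"
    by (rule gap_gf_cone2[where f = "\<lambda>(a, b). (a, b, a + b, b)" and g = "\<lambda>(p, q, r, s). (p, q)"]) auto
  also have "gap_gf (\<lambda>z. of_bool (case z of (p, q, r, s) \<Rightarrow> 0 < p \<and> q = p \<and> r = 2 * p \<and> s = p)) = ray 8"
    by (rule gap_gf_cone1[where f = "\<lambda>a. (a, a, 2 * a, a)" and g = "\<lambda>(p, q, r, s). p"]) auto
  also have "gap_gf (\<lambda>z. of_bool (case z of (p, q, r, s) \<Rightarrow> 0 < p \<and> 0 < q \<and> r = p + q \<and> s = p + q)) = ray 5 * ray 4"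
    by (rule gap_gf_cone2[where f = "\<lambda>(a, b). (a, b, a + b, a + b)" and g = "\<lambda>(p, q, r, s). (p, q)"]) auto
  finally show ?thesis .
qed

text \<open>The first triple is \<open>(0, p, p)\<close>, whose distances are 0 and
  \<open>p\<close>, so this region is separation from a triple with distinct entries. The events
  \<open>p = r\<close> and \<open>p = s\<close> meet where \<open>r = s\<close>; both are disjoint
  from \<open>p = r + s\<close>.\<close>

lemma gap_gf_upper_gap_zero:
  "gap_gf (\<lambda>z. of_bool (case z of (p, q, r, s) \<Rightarrow> 0 < p \<and> q = 0 \<and> 0 < r \<and> 0 < s \<and> p \<notin> {r, s, r + s})) =
     ray 2 * ray 2 * ray 1
     - ray 4 * ray 1
     - ray 2 * ray 3
     + ray 5
     - ray 4 * ray 3"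
    (is "gap_gf (\<lambda>z. of_bool (?P z)) = _")
proof -
  have "gap_gf (\<lambda>z. of_bool (?P z)) = gap_gf (\<lambda>z.
       of_bool (case z of (p, q, r, s) \<Rightarrow> 0 < p \<and> q = 0 \<and> 0 < r \<and> 0 < s)
       - of_bool (case z of (p, q, r, s) \<Rightarrow> p = r \<and> q = 0 \<and> 0 < r \<and> 0 < s)
       - of_bool (case z of (p, q, r, s) \<Rightarrow> p = s \<and> q = 0 \<and> 0 < r \<and> 0 < s)
       + of_bool (case z of (p, q, r, s) \<Rightarrow> p = r \<and> q = 0 \<and> 0 < r \<and> s = r)
       - of_bool (case z of (p, q, r, s) \<Rightarrow> p = r + s \<and> q = 0 \<and> 0 < r \<and> 0 < s))"
    (is "_ = gap_gf ?sum")
  proof (rule arg_cong[where f = gap_gf], rule ext)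
    fix z :: gaps
    obtain p q r s where z: "z = (p, q, r, s)" by (cases z)
    show "of_bool (?P z) = ?sum z"
      unfolding z prod.case
      by (cases "p = r"; cases "p = s"; auto)
  qed
  also have "\<dots> = gap_gf (\<lambda>z. of_bool (case z of (p, q, r, s) \<Rightarrow> 0 < p \<and> q = 0 \<and> 0 < r \<and> 0 < s))
      - gap_gf (\<lambda>z. of_bool (case z of (p, q, r, s) \<Rightarrow> p = r \<and> q = 0 \<and> 0 < r \<and> 0 < s))
      - gap_gf (\<lambda>z. of_bool (case z of (p, q, r, s) \<Rightarrow> p = s \<and> q = 0 \<and> 0 < r \<and> 0 < s))
      + gap_gf (\<lambda>z. of_bool (case z of (p, q, r, s) \<Rightarrow> p = r \<and> q = 0 \<and> 0 < r \<and> s = r))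
      - gap_gf (\<lambda>z. of_bool (case z of (p, q, r, s) \<Rightarrow> p = r + s \<and> q = 0 \<and> 0 < r \<and> 0 < s))"
    unfolding gap_gf_linear
    by (rule refl)
  also have "gap_gf (\<lambda>z. of_bool (case z of (p, q, r, s) \<Rightarrow> 0 < p \<and> q = 0 \<and> 0 < r \<and> 0 < s)) = ray 2 * ray 2 * ray 1"
    by (rule gap_gf_cone3[where f = "\<lambda>(a, b, c). (a, 0, b, c)" and g = "\<lambda>(p, q, r, s). (p, r, s)"]) auto
  also have "gap_gf (\<lambda>z. of_bool (case z of (p, q, r, s) \<Rightarrow> p = r \<and> q = 0 \<and> 0 < r \<and> 0 < s)) = ray 4 * ray 1"
    by (rule gap_gf_cone2[where f = "\<lambda>(a, b). (a, 0, a, b)" and g = "\<lambda>(p, q, r, s). (r, s)"]) auto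
  also have "gap_gf (\<lambda>z. of_bool (case z of (p, q, r, s) \<Rightarrow> p = s \<and> q = 0 \<and> 0 < r \<and> 0 < s)) = ray 2 * ray 3"
    by (rule gap_gf_cone2[where f = "\<lambda>(a, b). (b, 0, a, b)" and g = "\<lambda>(p, q, r, s). (r, s)"]) auto
  also have "gap_gf (\<lambda>z. of_bool (case z of (p, q, r, s) \<Rightarrow> p = r \<and> q = 0 \<and> 0 < r \<and> s = r)) = ray 5"
    by (rule gap_gf_cone1[where f = "\<lambda>a. (a, 0, a, a)" and g = "\<lambda>(p, q, r, s). r"]) auto
  also have "gap_gf (\<lambda>z. of_bool (case z of (p, q, r, s) \<Rightarrow> p = r + s \<and> q = 0 \<and> 0 < r \<and> 0 < s)) = ray 4 * ray 3"
    by (rule gap_gf_cone2[where f = "\<lambda>(a, b). (a + b, 0, a, b)" and g = "\<lambda>(p, q, r, s). (r, s)"]) auto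
  finally show ?thesis .
qed

text \<open>The counterpart for the triple \<open>(0, 0, q)\<close>, where the free gap has weight 1
  instead of 2.\<close>

lemma gap_gf_lower_gap_zero:
  "gap_gf (\<lambda>z. of_bool (case z of (p, q, r, s) \<Rightarrow> p = 0 \<and> 0 < q \<and> 0 < r \<and> 0 < s \<and> q \<notin> {r, s, r + s})) =
     ray 1 * ray 2 * ray 1
     - ray 3 * ray 1
     - ray 2 * ray 2
     + ray 4
     - ray 3 * ray 2"
    (is "gap_gf (\<lambda>z. of_bool (?P z)) = _")
proof -
  have "gap_gf (\<lambda>z. of_bool (?P z)) = gap_gf (\<lambda>z.
       of_bool (case z of (p, q, r, s) \<Rightarrow> p = 0 \<and> 0 < q \<and> 0 < r \<and> 0 < s)
       - of_bool (case z of (p, q, r, s) \<Rightarrow> p = 0 \<and> q = r \<and> 0 < r \<and> 0 < s)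
       - of_bool (case z of (p, q, r, s) \<Rightarrow> p = 0 \<and> q = s \<and> 0 < r \<and> 0 < s)
       + of_bool (case z of (p, q, r, s) \<Rightarrow> p = 0 \<and> q = r \<and> 0 < r \<and> s = r)
       - of_bool (case z of (p, q, r, s) \<Rightarrow> p = 0 \<and> q = r + s \<and> 0 < r \<and> 0 < s))"
    (is "_ = gap_gf ?sum")
  proof (rule arg_cong[where f = gap_gf], rule ext)
    fix z :: gaps
    obtain p q r s where z: "z = (p, q, r, s)" by (cases z)
    show "of_bool (?P z) = ?sum z"
      unfolding z prod.case
      by (cases "q = r"; cases "q = s"; auto)
  qed
  also have "\<dots> = gap_gf (\<lambda>z. of_bool (case z of (p, q, r, s) \<Rightarrow> p = 0 \<and> 0 < q \<and> 0 < r \<and> 0 < s))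
      - gap_gf (\<lambda>z. of_bool (case z of (p, q, r, s) \<Rightarrow> p = 0 \<and> q = r \<and> 0 < r \<and> 0 < s))
      - gap_gf (\<lambda>z. of_bool (case z of (p, q, r, s) \<Rightarrow> p = 0 \<and> q = s \<and> 0 < r \<and> 0 < s))
      + gap_gf (\<lambda>z. of_bool (case z of (p, q, r, s) \<Rightarrow> p = 0 \<and> q = r \<and> 0 < r \<and> s = r))
      - gap_gf (\<lambda>z. of_bool (case z of (p, q, r, s) \<Rightarrow> p = 0 \<and> q = r + s \<and> 0 < r \<and> 0 < s))"
    unfolding gap_gf_linear
    by (rule refl)
  also have "gap_gf (\<lambda>z. of_bool (case z of (p, q, r, s) \<Rightarrow> p = 0 \<and> 0 < q \<and> 0 < r \<and> 0 < s)) = ray 1 * ray 2 * ray 1"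
    by (rule gap_gf_cone3[where f = "\<lambda>(a, b, c). (0, a, b, c)" and g = "\<lambda>(p, q, r, s). (q, r, s)"]) auto
  also have "gap_gf (\<lambda>z. of_bool (case z of (p, q, r, s) \<Rightarrow> p = 0 \<and> q = r \<and> 0 < r \<and> 0 < s)) = ray 3 * ray 1"
    by (rule gap_gf_cone2[where f = "\<lambda>(a, b). (0, a, a, b)" and g = "\<lambda>(p, q, r, s). (r, s)"]) auto
  also have "gap_gf (\<lambda>z. of_bool (case z of (p, q, r, s) \<Rightarrow> p = 0 \<and> q = s \<and> 0 < r \<and> 0 < s)) = ray 2 * ray 2"
    by (rule gap_gf_cone2[where f = "\<lambda>(a, b). (0, b, a, b)" and g = "\<lambda>(p, q, r, s). (r, s)"]) auto
  also have "gap_gf (\<lambda>z. of_bool (case z of (p, q, r, s) \<Rightarrow> p = 0 \<and> q = r \<and> 0 < r \<and> s = r)) = ray 4"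
    by (rule gap_gf_cone1[where f = "\<lambda>a. (0, a, a, a)" and g = "\<lambda>(p, q, r, s). r"]) auto
  also have "gap_gf (\<lambda>z. of_bool (case z of (p, q, r, s) \<Rightarrow> p = 0 \<and> q = r + s \<and> 0 < r \<and> 0 < s)) = ray 3 * ray 2"
    by (rule gap_gf_cone2[where f = "\<lambda>(a, b). (0, a + b, a, b)" and g = "\<lambda>(p, q, r, s). (r, s)"]) auto
  finally show ?thesis .
qed

lemma gap_gf_both_gaps_zero:
  "gap_gf (\<lambda>z. of_bool (case z of (p, q, r, s) \<Rightarrow> p = 0 \<and> q = 0 \<and> 0 < r \<and> 0 < s)) = ray 2 * ray 1"
  by (rule gap_gf_cone2[where f = "\<lambda>(a, b). (0, 0, a, b)" and g = "\<lambda>(p, q, r, s). (r, s)"]) auto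

text \<open>The number of distinct rearrangements of \<open>(0, p, p + q)\<close>.\<close>

definition orders :: "nat \<Rightarrow> nat \<Rightarrow> nat" where
  "orders p q = (if p = 0 \<and> q = 0 then 1 else if p = 0 \<or> q = 0 then 3 else 6)"

text \<open>Inclusion-exclusion for the two events that \<open>r\<close> and that \<open>s\<close>
  coincides with a distance of the first triple.\<close>

lemma gap_gf_coincidence:
  "gap_gf (\<lambda>z. of_bool (case z of (p, q, r, s) \<Rightarrow>
       0 < p \<and> 0 < q \<and> 0 < r \<and> 0 < s \<and> p + q < r + s \<and> (r \<in> {p, q, p + q} \<or> s \<in> {p, q, p + q}))) =
     (ray 4 * ray 2 * ray 1 + ray 3 * ray 3 * ray 1 - ray 6 * ray 1 + ray 4 * ray 3 * ray 1)
   + (ray 3 * ray 3 * ray 2 + ray 4 * ray 2 * ray 2 - ray 6 * ray 2 + ray 3 * ray 2 * ray 2)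
   - (ray 5 * ray 6 + ray 6 * ray 4 + ray 5 * ray 2 + ray 3 * ray 4 - ray 7
      + ray 5 * ray 3 + ray 4 * ray 4 - ray 8 + ray 5 * ray 4)"
  unfolding gap_gf_r_coincides[symmetric] gap_gf_s_coincides[symmetric]
    gap_gf_both_coincide[symmetric] gap_gf_linear[symmetric]
  by (rule arg_cong[where f = gap_gf], rule ext) (auto split: prod.split)

text \<open>Equal spreads are already a coincidence. If \<open>p + q < r + s\<close>, then
  \<open>r + s\<close> exceeds every distance of the first triple, so a coincidence involves
  \<open>r\<close> or \<open>s\<close>. The opposite inequality gives the same series after swapping
  the triples, hence the factor 2.\<close>

lemma gap_gf_positive_separated:
  "gap_gf (\<lambda>z. of_bool (positive z \<and> separated z)) =
     ray 2 * ray 1 * ray 2 * ray 1 - (ray 4 * ray 3 * ray 2 + ray 4 * ray 3 * ray 2 + ray 4 * ray 2)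
   - fps_const 2 * gap_gf (\<lambda>z. of_bool (case z of (p, q, r, s) \<Rightarrow>
       0 < p \<and> 0 < q \<and> 0 < r \<and> 0 < s \<and> p + q < r + s \<and> (r \<in> {p, q, p + q} \<or> s \<in> {p, q, p + q})))"
    (is "_ = _ - _ * gap_gf (\<lambda>z. of_bool (?P z))")
proof -
  have "gap_gf (\<lambda>z. of_bool (positive z \<and> separated z)) =
      gap_gf (\<lambda>z. of_bool (positive z)
        - of_bool (case z of (p, q, r, s) \<Rightarrow> 0 < p \<and> 0 < q \<and> 0 < r \<and> 0 < s \<and> p + q = r + s)
        - of_bool (?P z) - (case z of (p, q, r, s) \<Rightarrow> of_bool (?P (r, s, p, q))))"
    (is "_ = gap_gf ?sum")
  proof (rule arg_cong[where f = gap_gf], rule ext)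
    fix z :: gaps
    obtain p q r s where z: "z = (p, q, r, s)" by (cases z)
    show "of_bool (positive z \<and> separated z) = ?sum z"
      unfolding z prod.case by (cases "p + q" "r + s" rule: linorder_cases) auto
  qed
  also have "\<dots> = gap_gf (\<lambda>z. of_bool (positive z))
      - gap_gf (\<lambda>z. of_bool (case z of (p, q, r, s) \<Rightarrow> 0 < p \<and> 0 < q \<and> 0 < r \<and> 0 < s \<and> p + q = r + s))
      - gap_gf (\<lambda>z. of_bool (?P z)) - gap_gf (\<lambda>(p, q, r, s). of_bool (?P (r, s, p, q)))"
    unfolding gap_gf_linear by (rule refl)
  also have "gap_gf (\<lambda>(p, q, r, s). of_bool (?P (r, s, p, q))) = gap_gf (\<lambda>z. of_bool (?P z))"
    by (rule gap_gf_swap)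
  finally show ?thesis
    unfolding gap_gf_positive gap_gf_equal_spread
    by (simp add: numeral_fps_const[symmetric])
qed

text \<open>A triple with a repeated entry has 0 among its distances, so at most one triple of a
  separated tuple is of this kind. The numbers of orders multiply to \<open>6 * 6 = 36\<close>,
  \<open>3 * 6 = 18\<close> and \<open>1 * 6 = 6\<close>; the last two are doubled because either
  triple may be the degenerate one.\<close>

lemma gap_gf_separated:
  "gap_gf (\<lambda>(p, q, r, s). real (orders p q * orders r s) * of_bool (separated (p, q, r, s))) =
     fps_const 36 * gap_gf (\<lambda>z. of_bool (positive z \<and> separated z))
   + fps_const 36 * (ray 2 * ray 2 * ray 1 - ray 4 * ray 1 - ray 2 * ray 3 + ray 5 - ray 4 * ray 3)
   + fps_const 36 * (ray 1 * ray 2 * ray 1 - ray 3 * ray 1 - ray 2 * ray 2 + ray 4 - ray 3 * ray 2)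
   + fps_const 12 * (ray 2 * ray 1)"
proof -
  let ?U = "\<lambda>z. of_bool (case z of (p, q, r, s) \<Rightarrow> 0 < p \<and> q = 0 \<and> 0 < r \<and> 0 < s \<and> p \<notin> {r, s, r + s}) :: real"
  let ?L = "\<lambda>z. of_bool (case z of (p, q, r, s) \<Rightarrow> p = 0 \<and> 0 < q \<and> 0 < r \<and> 0 < s \<and> q \<notin> {r, s, r + s}) :: real"
  let ?B = "\<lambda>z. of_bool (case z of (p, q, r, s) \<Rightarrow> p = 0 \<and> q = 0 \<and> 0 < r \<and> 0 < s) :: real"
  let ?N = "\<lambda>z. 18 * ?U z + 18 * ?L z + 6 * ?B z"
  have "gap_gf (\<lambda>(p, q, r, s). real (orders p q * orders r s) * of_bool (separated (p, q, r, s))) =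
     gap_gf (\<lambda>z. 36 * of_bool (positive z \<and> separated z) + ?N z + (case z of (p, q, r, s) \<Rightarrow> ?N (r, s, p, q)))"
    (is "gap_gf ?lhs = gap_gf ?sum")
  proof (rule arg_cong[where f = gap_gf], rule ext)
    fix z :: gaps
    obtain p q r s where z: "z = (p, q, r, s)" by (cases z)
    show "?lhs z = ?sum z"
      unfolding z prod.case orders_def
      by (cases "p = 0"; cases "q = 0"; cases "r = 0"; cases "s = 0"; auto)
  qed
  also have "\<dots> = fps_const 36 * gap_gf (\<lambda>z. of_bool (positive z \<and> separated z)) + gap_gf ?N + gap_gf ?N"
    by (simp only: gap_gf_linear gap_gf_swap[of ?N])
  also have "gap_gf ?N = fps_const 18 * gap_gf ?U + fps_const 18 * gap_gf ?L + fps_const 6 * gap_gf ?B"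
    by (simp only: gap_gf_linear)
  finally show ?thesis
    unfolding gap_gf_upper_gap_zero gap_gf_lower_gap_zero gap_gf_both_gaps_zero
    by (simp add: numeral_fps_const[symmetric] algebra_simps)
qed

section \<open>Magilatin squares as addition tables\<close>

lemma inj_3_iff: "inj f \<longleftrightarrow> f 1 \<noteq> f 2 \<and> f 1 \<noteq> f 3 \<and> f 2 \<noteq> f (3 :: 3)"
  unfolding inj_def forall_3 by auto

lemma magilatin_square_iff:
  "magilatin_square t A \<longleftrightarrow>
     0 < A$1$1 \<and> 0 < A$1$2 \<and> 0 < A$1$3 \<and> 0 < A$2$1 \<and> 0 < A$2$2 \<and> 0 < A$2$3 \<and>
     0 < A$3$1 \<and> 0 < A$3$2 \<and> 0 < A$3$3 \<and>
     A$1$1 + A$1$2 + A$1$3 = t \<and> A$2$1 + A$2$2 + A$2$3 = t \<and> A$3$1 + A$3$2 + A$3$3 = t \<and>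
     A$1$1 + A$2$1 + A$3$1 = t \<and> A$1$2 + A$2$2 + A$3$2 = t \<and> A$1$3 + A$2$3 + A$3$3 = t \<and>
     A$1$1 \<noteq> A$1$2 \<and> A$1$1 \<noteq> A$1$3 \<and> A$1$2 \<noteq> A$1$3 \<and>
     A$2$1 \<noteq> A$2$2 \<and> A$2$1 \<noteq> A$2$3 \<and> A$2$2 \<noteq> A$2$3 \<and>
     A$3$1 \<noteq> A$3$2 \<and> A$3$1 \<noteq> A$3$3 \<and> A$3$2 \<noteq> A$3$3 \<and>
     A$1$1 \<noteq> A$2$1 \<and> A$1$1 \<noteq> A$3$1 \<and> A$2$1 \<noteq> A$3$1 \<and>
     A$1$2 \<noteq> A$2$2 \<and> A$1$2 \<noteq> A$3$2 \<and> A$2$2 \<noteq> A$3$2 \<and>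
     A$1$3 \<noteq> A$2$3 \<and> A$1$3 \<noteq> A$3$3 \<and> A$2$3 \<noteq> A$3$3"
  unfolding magilatin_square_def inj_3_iff forall_3 sum_3 by blast

section \<open>Rearrangements of normalized triples and their addition tables\<close>

type_synonym triple = "nat \<times> nat \<times> nat"

fun arrangements :: "nat \<times> nat \<Rightarrow> triple set" where
  "arrangements (p, q) = {(0, p, p + q), (0, p + q, p), (p, 0, p + q), (p + q, 0, p), (p, p + q, 0), (p + q, p, 0)}"

lemma card_arrangements: "card (arrangements (p, q)) = orders p q"
  by (auto simp: orders_def card_insert_if)

lemma arrangements_disjoint:
  "a \<in> arrangements g \<Longrightarrow> a \<in> arrangements h \<Longrightarrow> g = h"
  by (cases g; cases h) auto

lemma arrangements_zero: "(u0, u1, u2) \<in> arrangements g \<Longrightarrow> u0 = 0 \<or> u1 = 0 \<or> u2 = 0"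
  by (cases g) auto

lemma arrangements_sum: "(u0, u1, u2) \<in> arrangements (p, q) \<Longrightarrow> u0 + u1 + u2 = 2 * p + q"
  by auto

lemma arrangements_exhaust:
  assumes "u0 = 0 \<or> u1 = 0 \<or> u2 = 0"
  obtains p q where "(u0, u1, u2) \<in> arrangements (p, q)"
proof -
  \<comment> \<open>The gaps are read off the two entries other than a chosen zero: the smaller one
    is \<open>p\<close>, their difference is \<open>q\<close>.\<close>
  have "(0, b, c) \<in> arrangements (min b c, max b c - min b c)" for b c
    by (auto simp: min_def max_def)
  moreover have "(b, 0, c) \<in> arrangements (min b c, max b c - min b c)" for b c
    by (auto simp: min_def max_def)
  moreover have "(b, c, 0) \<in> arrangements (min b c, max b c - min b c)" for b c
    by (auto simp: min_def max_def)
  ultimately show thesis using assms that by metis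
qed

text \<open>Rows and columns are the six transversals of the table of the sums of \<open>u\<close> and \<open>v\<close>.\<close>

fun square :: "nat \<Rightarrow> triple \<Rightarrow> triple \<Rightarrow> nat ^ 3 ^ 3" where
  "square x (u0, u1, u2) (v0, v1, v2) =
     vector [vector [x + u0 + v0, x + u1 + v1, x + u2 + v2],
             vector [x + u2 + v1, x + u0 + v2, x + u1 + v0],
             vector [x + u1 + v2, x + u2 + v0, x + u0 + v1]]"

fun distances :: "triple \<Rightarrow> int set" where
  "distances (u0, u1, u2) = {\<bar>int u0 - int u1\<bar>, \<bar>int u1 - int u2\<bar>, \<bar>int u0 - int u2\<bar>}"

lemma distances_arrangements:
  "a \<in> arrangements (p, q) \<Longrightarrow> distances a = int ` {p, q, p + q}"
  by auto

text \<open>With the absolute values resolved, a distance of \<open>u\<close> that equals a distance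
  of \<open>v\<close> becomes an equality between two sums of the kind that fill the table.\<close>

lemma distance_eq_iff:
  "\<bar>int i - int j\<bar> = \<bar>int k - int l\<bar> \<longleftrightarrow> i + l = j + k \<or> i + k = j + l"
  by (simp add: abs_eq_iff) linarith

text \<open>A line uses each entry of \<open>u\<close> and of \<open>v\<close> once, so all line
  sums agree. Two cells share a line exactly when they differ in both indices; the 18 such pairs
  match the two sign choices for each of the nine pairs of distances.\<close>

lemma magilatin_square_square_iff:
  assumes "0 < x"
  shows "magilatin_square t (square x (u0, u1, u2) (v0, v1, v2)) \<longleftrightarrow>
    3 * x + (u0 + u1 + u2) + (v0 + v1 + v2) = t \<and>
    distances (u0, u1, u2) \<inter> distances (v0, v1, v2) = {}"
proof -
  have "3 * x + (u0 + u1 + u2) + (v0 + v1 + v2) = t \<longleftrightarrow>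
    x + u0 + v0 + (x + u1 + v1) + (x + u2 + v2) = t"
    by linarith
  then show ?thesis
    unfolding magilatin_square_iff square.simps vector_3 distances.simps
      Int_insert_left Int_empty_left insert_iff empty_iff distance_eq_iff
    using assms by (simp add: ac_simps) (safe; simp)
qed

text \<open>Since both triples contain 0, \<open>x\<close> is the least entry of the table. Once it
  is known, a zero of one triple exposes the entries of the other.\<close>

lemma square_inject:
  assumes eq: "square x a b = square y c d"
    and "a \<in> arrangements g" "b \<in> arrangements h" "c \<in> arrangements g'" "d \<in> arrangements h'"
  shows "x = y \<and> a = c \<and> b = d"
proof -
  obtain u0 u1 u2 v0 v1 v2 c0 c1 c2 d0 d1 d2 where
    abcd: "a = (u0, u1, u2)" "b = (v0, v1, v2)" "c = (c0, c1, c2)" "d = (d0, d1, d2)"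
    by (metis surj_pair)
  have zero: "u0 = 0 \<or> u1 = 0 \<or> u2 = 0" "v0 = 0 \<or> v1 = 0 \<or> v2 = 0"
    "c0 = 0 \<or> c1 = 0 \<or> c2 = 0" "d0 = 0 \<or> d1 = 0 \<or> d2 = 0"
    using assms(2-5) unfolding abcd by (blast dest: arrangements_zero)+
  have e: "x + u0 + v0 = y + c0 + d0" "x + u0 + v1 = y + c0 + d1" "x + u0 + v2 = y + c0 + d2"
    "x + u1 + v0 = y + c1 + d0" "x + u1 + v1 = y + c1 + d1" "x + u1 + v2 = y + c1 + d2"
    "x + u2 + v0 = y + c2 + d0" "x + u2 + v1 = y + c2 + d1" "x + u2 + v2 = y + c2 + d2"
    using eq unfolding abcd by (simp_all add: vec_eq_iff forall_3)
  have "y \<le> x" using zero(1,2) e by (elim disjE) linarith+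
  moreover have "x \<le> y" using zero(3,4) e by (elim disjE) linarith+
  ultimately have xy: "x = y" by simp
  have "c0 \<le> u0 \<and> c1 \<le> u1 \<and> c2 \<le> u2" using zero(2) e xy by (elim disjE) linarith+
  moreover have "u0 \<le> c0 \<and> u1 \<le> c1 \<and> u2 \<le> c2" using zero(4) e xy by (elim disjE) linarith+
  ultimately have "a = c" unfolding abcd by simp
  with e xy show ?thesis unfolding abcd by simp
qed

lemma square_exhaust:
  assumes "magilatin_square t A"
  obtains x u0 u1 u2 v0 v1 v2 where "A = square x (u0, u1, u2) (v0, v1, v2)" "0 < x"
    "u0 = 0 \<or> u1 = 0 \<or> u2 = 0" "v0 = 0 \<or> v1 = 0 \<or> v2 = 0"
proof -
  \<comment> \<open>In the table the cells \<open>A$1$1\<close>, \<open>A$2$3\<close>,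
    \<open>A$3$2\<close> share the summand \<open>v0\<close>, and \<open>A$1$1\<close>,
    \<open>A$3$3\<close>, \<open>A$2$2\<close> share \<open>u0\<close>. Their minima therefore
    locate a least entry of each triple.\<close>
  define u where "u = Min {A$1$1, A$2$3, A$3$2}"
  define v where "v = Min {A$1$1, A$3$3, A$2$2}"
  have u: "u \<le> A$1$1" "u \<le> A$2$3" "u \<le> A$3$2" "u = A$1$1 \<or> u = A$2$3 \<or> u = A$3$2"
    unfolding u_def by (auto simp: min_def)
  have v: "v \<le> A$1$1" "v \<le> A$3$3" "v \<le> A$2$2" "v = A$1$1 \<or> v = A$3$3 \<or> v = A$2$2"
    unfolding v_def by (auto simp: min_def)
  have m: "0 < A$1$1" "0 < A$1$2" "0 < A$1$3" "0 < A$2$1" "0 < A$2$2" "0 < A$2$3"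
    "0 < A$3$1" "0 < A$3$2" "0 < A$3$3"
    "A$1$1 + A$1$2 + A$1$3 = t" "A$2$1 + A$2$2 + A$2$3 = t" "A$3$1 + A$3$2 + A$3$3 = t"
    "A$1$1 + A$2$1 + A$3$1 = t" "A$1$2 + A$2$2 + A$3$2 = t" "A$1$3 + A$2$3 + A$3$3 = t"
    using assms unfolding magilatin_square_iff by simp_all
  \<comment> \<open>By the equal line sums, \<open>u + v - A$1$1\<close> is an entry of the square,
    the one where the two least summands meet. So it is positive, and the subtraction of naturals is
    not truncated.\<close>
  have pos: "0 < u + v - A$1$1"
    using m u(4) v(4) by (elim disjE) linarith+
  show thesis
  proof (rule that)
    show "A = square (u + v - A$1$1) (A$1$1 - u, A$2$3 - u, A$3$2 - u) (A$1$1 - v, A$3$3 - v, A$2$2 - v)"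
      using m u(1-3) v(1-3) pos
      unfolding vec_eq_iff forall_3 square.simps vector_3
      by (intro conjI) linarith+
  qed (use u v pos in auto)
qed

section \<open>Counting squares by least entry and gaps\<close>

definition frames :: "nat \<Rightarrow> (nat \<times> gaps) set" where
  "frames t = {(x, p, q, r, s). 0 < x \<and> 3 * x + gap_weight (p, q, r, s) = t \<and> separated (p, q, r, s)}"

text \<open>A square arises exactly once from a frame and rearrangements of its two triples:
  existence is \<open>square_exhaust\<close>, uniqueness is \<open>square_inject\<close> together
  with \<open>arrangements_disjoint\<close>.\<close>

lemma L_a_eq_sum:
  "L_a t = (\<Sum>(x, p, q, r, s) \<in> frames t. orders p q * orders r s)"
proof -
  define I where "I = (SIGMA (x, p, q, r, s) : frames t. arrangements (p, q) \<times> arrangements (r, s))"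
  define f where "f = (\<lambda>((x, p :: nat, q :: nat, r :: nat, s :: nat), a, b). square x a b)"
  have mem: "magilatin_square t (square x a b) \<longleftrightarrow> (x, p, q, r, s) \<in> frames t"
    if "0 < x" "a \<in> arrangements (p, q)" "b \<in> arrangements (r, s)" for x p q r s a b
  proof -
    obtain u0 u1 u2 v0 v1 v2 where ab: "a = (u0, u1, u2)" "b = (v0, v1, v2)" by (metis surj_pair)
    have "u0 + u1 + u2 = 2 * p + q" "v0 + v1 + v2 = 2 * r + s"
      using that arrangements_sum unfolding ab by blast+
    moreover have "distances a \<inter> distances b = {} \<longleftrightarrow> separated (p, q, r, s)"
      unfolding distances_arrangements[OF that(2)] distances_arrangements[OF that(3)]
        image_Int[OF inj_of_nat, symmetric] by simp
    ultimately show ?thesis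
      using magilatin_square_square_iff[of x t u0 u1 u2 v0 v1 v2] that(1)
      unfolding ab frames_def by (simp add: add.assoc)
  qed
  have "bij_betw f I {A. magilatin_square t A}"
  proof (rule bij_betwI')
    fix i j assume ij: "i \<in> I" "j \<in> I"
    obtain x p q r s a b y p' q' r' s' c d where
      eqs: "i = ((x, p, q, r, s), a, b)" "j = ((y, p', q', r', s'), c, d)"
      by (metis surj_pair)
    have arr: "a \<in> arrangements (p, q)" "b \<in> arrangements (r, s)"
      "c \<in> arrangements (p', q')" "d \<in> arrangements (r', s')"
      using ij unfolding I_def eqs by (simp_all del: arrangements.simps)
    show "f i = f j \<longleftrightarrow> i = j"
    proof
      assume "f i = f j"
      then have eq: "x = y \<and> a = c \<and> b = d"
        unfolding f_def eqs prod.case by (rule square_inject) (fact arr)+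
      with arr have "(p, q) = (p', q')" "(r, s) = (r', s')"
        by (metis arrangements_disjoint)+
      with eq show "i = j" unfolding eqs by simp
    qed simp
  next
    fix i assume "i \<in> I"
    then obtain x p q r s a b where "i = ((x, p, q, r, s), a, b)" "(x, p, q, r, s) \<in> frames t"
      "a \<in> arrangements (p, q)" "b \<in> arrangements (r, s)"
      unfolding I_def by (auto simp del: arrangements.simps)
    moreover from this have "0 < x" by (simp add: frames_def)
    ultimately show "f i \<in> {A. magilatin_square t A}"
      unfolding f_def using mem by simp
  next
    fix A assume "A \<in> {A. magilatin_square t A}"
    then have A: "magilatin_square t A" by simp
    then obtain x u0 u1 u2 v0 v1 v2 where A_eq: "A = square x (u0, u1, u2) (v0, v1, v2)" and x: "0 < x"
      and zero: "u0 = 0 \<or> u1 = 0 \<or> u2 = 0" "v0 = 0 \<or> v1 = 0 \<or> v2 = 0"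
      by (rule square_exhaust)
    obtain p q where pq: "(u0, u1, u2) \<in> arrangements (p, q)"
      using zero(1) by (rule arrangements_exhaust)
    obtain r s where rs: "(v0, v1, v2) \<in> arrangements (r, s)"
      using zero(2) by (rule arrangements_exhaust)
    have "(x, p, q, r, s) \<in> frames t"
      using mem[OF x pq rs] A A_eq by simp
    with pq rs A_eq show "\<exists>i \<in> I. A = f i"
      unfolding I_def f_def
      by (intro bexI[of _ "((x, p, q, r, s), (u0, u1, u2), (v0, v1, v2))"]) (auto simp del: arrangements.simps)
  qed
  then have "L_a t = card I"
    unfolding L_a_def by (simp add: bij_betw_same_card)
  also have "\<dots> = (\<Sum>i \<in> frames t. case i of (x, p, q, r, s) \<Rightarrow> card (arrangements (p, q) \<times> arrangements (r, s)))"
    unfolding I_def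
  proof (subst card_SigmaI)
    show "finite (frames t)"
      by (rule finite_subset[of _ "{..t} \<times> {..t} \<times> {..t} \<times> {..t} \<times> {..t}"]) (auto simp: frames_def)
  qed (auto intro!: sum.cong)
  finally show ?thesis
    by (simp add: card_cartesian_product card_arrangements case_prod_unfold del: arrangements.simps)
qed

text \<open>The least entry adds \<open>3 * x\<close> to the magic sum and does not affect
  separation, so it splits off as the factor \<open>ray 3\<close>.\<close>

lemma L_a_gf:
  "Abs_fps (\<lambda>t. real (L_a t)) =
     ray 3 * gap_gf (\<lambda>(p, q, r, s). real (orders p q * orders r s) * of_bool (separated (p, q, r, s)))"
    (is "_ = ray 3 * gap_gf ?m")
proof -
  have "ray 3 * gap_gf ?m =
      weighted_gf ({0<..} \<times> UNIV) (\<lambda>(x, z). 3 * x + gap_weight z) (\<lambda>(x, z). 1 * ?m z)"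
    unfolding ray_def gap_gf_def by (rule weighted_gf_product[OF finite_ray finite_gaps, symmetric]) simp
  also have "\<dots> = Abs_fps (\<lambda>t. real (L_a t))"
    unfolding weighted_gf_def
  proof (rule arg_cong[where f = Abs_fps], rule ext)
    fix t
    have "finite {xz. xz \<in> {0<..} \<times> UNIV \<and> (case xz of (x, z) \<Rightarrow> 3 * x + gap_weight z) = t}"
      by (rule finite_subset[of _ "{..t} \<times> {..t} \<times> {..t} \<times> {..t} \<times> {..t}"]) auto
    then show "(\<Sum>a | a \<in> {0<..} \<times> UNIV \<and> (case a of (x, z) \<Rightarrow> 3 * x + gap_weight z) = t.
        case a of (x, z) \<Rightarrow> 1 * ?m z) = real (L_a t)"
      unfolding L_a_eq_sum of_nat_sum
      by (intro sum.mono_neutral_cong_right) (auto simp: frames_def simp del: separated.simps)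
  qed
  finally show ?thesis ..
qed

section \<open>Clearing denominators\<close>

text \<open>Polynomials are represented by their coefficient lists, constant term first. Multiplication by
  \<open>1 - X\<^sup>k\<close> is then a shift and a subtraction.\<close>

fun list_sub :: "int list \<Rightarrow> int list \<Rightarrow> int list" where
  "list_sub [] ys = map uminus ys"
| "list_sub xs [] = xs"
| "list_sub (x # xs) (y # ys) = (x - y) # list_sub xs ys"

fun fps_of_list :: "int list \<Rightarrow> real fps" where
  "fps_of_list [] = 0"
| "fps_of_list (x # xs) = fps_const (of_int x) + fps_X * fps_of_list xs"

definition shift :: "nat \<Rightarrow> int list \<Rightarrow> int list" where
  "shift k xs = replicate k 0 @ xs"

definition dmul :: "nat \<Rightarrow> int list \<Rightarrow> int list" where
  "dmul k xs = list_sub xs (shift k xs)"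

lemma fps_of_list_uminus: "fps_of_list (map uminus xs) = - fps_of_list xs"
  by (induction xs) (simp_all add: fps_const_neg[symmetric] del: fps_const_neg)

lemma fps_of_list_sub: "fps_of_list (list_sub xs ys) = fps_of_list xs - fps_of_list ys"
  by (induction xs ys rule: list_sub.induct)
    (simp_all add: fps_of_list_uminus right_diff_distrib fps_const_sub[symmetric] del: fps_const_sub)

lemma fps_of_list_shift: "fps_of_list (shift k xs) = fps_X ^ k * fps_of_list xs"
  by (induction k) (simp_all add: shift_def mult.assoc)

lemma fps_of_list_dmul: "fps_of_list (dmul k xs) = (1 - fps_X ^ k) * fps_of_list xs"
  by (simp add: dmul_def fps_of_list_sub fps_of_list_shift algebra_simps)

lemma fps_of_list_fold_dmul:
  "fps_of_list (fold dmul ks xs) = (\<Prod>k\<leftarrow>ks. 1 - fps_X ^ k) * fps_of_list xs"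
  by (induction ks arbitrary: xs) (simp_all add: fps_of_list_dmul algebra_simps)

lemma fps_of_list_scale: "fps_of_list (map ((*) c) xs) = fps_const (of_int c) * fps_of_list xs"
  by (induction xs) (simp_all add: algebra_simps fps_const_mult[symmetric] del: fps_const_mult)

text \<open>Lists that differ by trailing zeros represent the same polynomial; the test is therefore
  that the difference vanishes, not that the lists are equal.\<close>

lemma fps_of_list_eqI:
  assumes "list_all ((=) 0) (list_sub xs ys)"
  shows "fps_of_list xs = fps_of_list ys"
proof -
  have "list_all ((=) 0) zs \<Longrightarrow> fps_of_list zs = 0" for zs
    by (induction zs) auto
  from this[OF assms] show ?thesis by (simp add: fps_of_list_sub)
qed

lemma fps_of_list_nth: "fps_nth (fps_of_list xs) n = (if n < length xs then of_int (xs ! n) else 0)"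
  by (induction xs arbitrary: n) (auto simp: nth_Cons split: nat.split)

definition term_sum :: "(int \<times> nat list) list \<Rightarrow> real fps" where
  "term_sum ts = (\<Sum>(c, ks)\<leftarrow>ts. fps_const (of_int c) * (\<Prod>k\<leftarrow>ks. ray k))"

text \<open>The coefficients of \<open>term_sum ts\<close> multiplied by all \<open>1 - X\<^sup>d\<close> for \<open>d\<close> in \<open>ds\<close>. For each term the
  factors left over are those of \<open>ds\<close> that are not in the denominator of the term.\<close>

fun cleared :: "nat list \<Rightarrow> (int \<times> nat list) list \<Rightarrow> int list" where
  "cleared ds [] = []"
| "cleared ds ((c, ks) # ts) =
     list_sub (cleared ds ts)
       (map ((*) (- c)) (fold dmul (fold remove1 ks ds) (shift (sum_list ks) [1])))"

text \<open>By \<open>ray_mult\<close> each \<open>ray k\<close> uses up one factor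
  \<open>1 - X^k\<close> and leaves \<open>X^k\<close>. The inclusion of multisets supplies a
  separate factor for every repetition of \<open>k\<close>.\<close>

lemma rays_cleared:
  assumes "mset ks \<subseteq># mset ds" "\<forall>k \<in> set ks. 0 < k"
  shows "(\<Prod>k\<leftarrow>ds. 1 - fps_X ^ k) * (\<Prod>k\<leftarrow>ks. ray k) =
    fps_of_list (fold dmul (fold remove1 ks ds) (shift (sum_list ks) [1]))"
  using assms
proof (induction ks arbitrary: ds)
  case Nil
  then show ?case by (simp add: fps_of_list_fold_dmul fps_of_list_shift)
next
  case (Cons k ks)
  have k: "k \<in> set ds"
    using Cons.prems(1) by (metis insert_subset list.set(2) set_mset_mono set_mset_mset)
  \<comment> \<open>As a product over a multiset, it can release the factor for \<open>k\<close>
    wherever \<open>k\<close> stands in \<open>ds\<close>.\<close>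
  have "(\<Prod>k\<leftarrow>ds. 1 - fps_X ^ k :: real fps) = prod_mset (image_mset (\<lambda>k. 1 - fps_X ^ k) (mset ds))"
    by (simp add: prod_mset_prod_list[symmetric] del: prod_mset_prod_list)
  also have "mset ds = add_mset k (mset (remove1 k ds))"
    using k by simp
  finally have "(\<Prod>k\<leftarrow>ds. 1 - fps_X ^ k :: real fps) = (1 - fps_X ^ k) * (\<Prod>k\<leftarrow>remove1 k ds. 1 - fps_X ^ k)"
    by (metis (no_types, lifting) image_mset_add_mset mset_map prod_mset.add_mset prod_mset_prod_list)
  moreover have "mset ks \<subseteq># mset (remove1 k ds)"
    using Cons.prems(1) by (simp add: insert_subset_eq_iff)
  ultimately have "(\<Prod>k\<leftarrow>ds. 1 - fps_X ^ k) * (\<Prod>k\<leftarrow>k # ks. ray k) =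
      ((1 - fps_X ^ k) * ray k) * fps_of_list (fold dmul (fold remove1 ks (remove1 k ds)) (shift (sum_list ks) [1]))"
    using Cons.IH[of "remove1 k ds"] Cons.prems(2) by (simp add: ac_simps)
  also have "\<dots> = fps_of_list (fold dmul (fold remove1 (k # ks) ds) (shift (sum_list (k # ks)) [1]))"
    using ray_mult[of k] Cons.prems(2)
    by (simp add: fps_of_list_fold_dmul fps_of_list_shift power_add ac_simps)
  finally show ?case .
qed

lemma term_sum_cleared:
  assumes "\<forall>(c, ks) \<in> set ts. mset ks \<subseteq># mset ds \<and> (\<forall>k \<in> set ks. 0 < k)"
  shows "(\<Prod>k\<leftarrow>ds. 1 - fps_X ^ k) * term_sum ts = fps_of_list (cleared ds ts)"
  using assms
proof (induction ts)
  case Nil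
  then show ?case by (simp add: term_sum_def)
next
  case (Cons t ts)
  obtain c ks where t: "t = (c, ks)" by (cases t)
  let ?p = "\<Prod>k\<leftarrow>ds. 1 - fps_X ^ k :: real fps"
  have "?p * term_sum (t # ts) = fps_const (of_int c) * (?p * (\<Prod>k\<leftarrow>ks. ray k)) + ?p * term_sum ts"
    by (simp add: term_sum_def t algebra_simps)
  also have "?p * (\<Prod>k\<leftarrow>ks. ray k) = fps_of_list (fold dmul (fold remove1 ks ds) (shift (sum_list ks) [1]))"
    by (rule rays_cleared) (use Cons.prems t in auto)
  also have "?p * term_sum ts = fps_of_list (cleared ds ts)"
    by (rule Cons.IH) (use Cons.prems in auto)
  finally show ?case
    by (simp add: t fps_of_list_sub fps_of_list_scale fps_const_neg[symmetric] del: fps_const_neg)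
qed

text \<open>This is the inclusion-exclusion sum multiplied out. The leading 3 of every list is the
  ray of the least entry. The first -72 merges the two equal cones of
  \<open>gap_gf_equal_spread\<close>; all other coefficients 72 and -72 carry the factor 2 from
  swapping the triples.\<close>

definition L_a_terms :: "(int \<times> nat list) list" where
  "L_a_terms =
     [(36, [3, 2, 1, 2, 1]),
      (-72, [3, 4, 3, 2]),
      (-36, [3, 4, 2]),
      (-72, [3, 4, 2, 1]),
      (-72, [3, 3, 3, 1]),
      (72, [3, 6, 1]),
      (-72, [3, 4, 3, 1]),
      (-72, [3, 3, 3, 2]),
      (-72, [3, 4, 2, 2]),
      (72, [3, 6, 2]),
      (-72, [3, 3, 2, 2]),
      (72, [3, 6, 5]),
      (72, [3, 6, 4]),
      (72, [3, 5, 2]),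
      (72, [3, 3, 4]),
      (-72, [3, 7]),
      (72, [3, 5, 3]),
      (72, [3, 4, 4]),
      (-72, [3, 8]),
      (72, [3, 5, 4]),
      (36, [3, 2, 2, 1]),
      (-36, [3, 4, 1]),
      (-36, [3, 2, 3]),
      (36, [3, 5]),
      (-36, [3, 4, 3]),
      (36, [3, 1, 2, 1]),
      (-36, [3, 3, 1]),
      (-36, [3, 2, 2]),
      (36, [3, 4]),
      (-36, [3, 3, 2]),
      (12, [3, 2, 1])]"

definition L_a_numerator :: "int list" where
  "L_a_numerator = shift 6 (map ((*) 12)
     [1, 3, 7, 15, 33, 65, 128, 208, 316, 434, 566, 676, 784, 852, 911, 936, 967, 967, 1001, 995, 1000,
      955, 893, 752, 624, 456, 322, 174, 79])"

text \<open>The long list holds each factor as often as the most demanding term requires. The short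
  list is its excess over the denominator in the theorem, given that
  \<open>(1 - X^3) * (1 - X^4)\<close> is \<open>(1 - X)^2\<close> times the first three factors
  there.\<close>

lemma cleared_L_a_terms:
  "list_all ((=) 0) (list_sub (cleared [1,1,2,2,3,3,3,4,4,5,6,7,8] L_a_terms)
     (fold dmul [1,1,1,1,2,2,3,4] L_a_numerator))"
  by code_simp

lemma L_a_terms_denominators:
  "\<forall>(c, ks) \<in> set L_a_terms. mset ks \<subseteq># mset [1,1,2,2,3,3,3,4,4,5,6,7,8] \<and> (\<forall>k \<in> set ks. 0 < k)"
  by (simp add: L_a_terms_def)

section \<open>The closed form\<close>

text \<open>With the rays replaced by ring variables, only the laws of commutative rings are
  involved. The nesting on the right copies the shape that unfolding \<open>term_sum\<close>
  produces.\<close>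

lemma gap_gf_terms_identity:
  fixes r1 r2 r3 r4 r5 r6 r7 r8 :: "'a :: comm_ring_1"
  shows
    "r3 * (36 * (r2 * r1 * r2 * r1 - (r4 * r3 * r2 + r4 * r3 * r2 + r4 * r2)
       - 2 * (r4 * r2 * r1 + r3 * r3 * r1 - r6 * r1 + r4 * r3 * r1
            + (r3 * r3 * r2 + r4 * r2 * r2 - r6 * r2 + r3 * r2 * r2)
            - (r5 * r6 + r6 * r4 + r5 * r2 + r3 * r4 - r7 + r5 * r3 + r4 * r4 - r8 + r5 * r4)))
     + 36 * (r2 * r2 * r1 - r4 * r1 - r2 * r3 + r5 - r4 * r3)
     + 36 * (r1 * r2 * r1 - r3 * r1 - r2 * r2 + r4 - r3 * r2)
     + 12 * (r2 * r1)) =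
     36 * (r3 * (r2 * (r1 * (r2 * r1)))) + ((- 72) * (r3 * (r4 * (r3 * r2))) + (
     (- 36) * (r3 * (r4 * r2)) + ((- 72) * (r3 * (r4 * (r2 * r1))) + (
     (- 72) * (r3 * (r3 * (r3 * r1))) + (72 * (r3 * (r6 * r1)) + ((- 72) * (r3 * (r4 * (r3 * r1))) + (
     (- 72) * (r3 * (r3 * (r3 * r2))) + ((- 72) * (r3 * (r4 * (r2 * r2))) + (72 * (r3 * (r6 * r2)) + (
     (- 72) * (r3 * (r3 * (r2 * r2))) + (72 * (r3 * (r6 * r5)) + (72 * (r3 * (r6 * r4)) + (
     72 * (r3 * (r5 * r2)) + (72 * (r3 * (r3 * r4)) + ((- 72) * (r3 * r7) + (72 * (r3 * (r5 * r3)) + (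
     72 * (r3 * (r4 * r4)) + ((- 72) * (r3 * r8) + (72 * (r3 * (r5 * r4)) + (
     36 * (r3 * (r2 * (r2 * r1))) + ((- 36) * (r3 * (r4 * r1)) + ((- 36) * (r3 * (r2 * r3)) + (
     36 * (r3 * r5) + ((- 36) * (r3 * (r4 * r3)) + (36 * (r3 * (r1 * (r2 * r1))) + (
     (- 36) * (r3 * (r3 * r1)) + ((- 36) * (r3 * (r2 * r2)) + (36 * (r3 * r4) + (
     (- 36) * (r3 * (r3 * r2)) + (12 * (r3 * (r2 * r1))))))))))))))))))))))))))))))))"
  by (simp add: algebra_simps)

lemma L_a_gf_terms: "Abs_fps (\<lambda>t. real (L_a t)) = term_sum L_a_terms"
  unfolding L_a_gf gap_gf_separated gap_gf_positive_separated gap_gf_coincidence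
    term_sum_def L_a_terms_def list.map prod_list.Cons prod_list.Nil sum_list.Cons sum_list.Nil prod.case
    mult_1_right add_0_right of_int_numeral of_int_neg_numeral
    numeral_fps_const[symmetric] neg_numeral_fps_const[symmetric]
  by (rule gap_gf_terms_identity)

section \<open>The rational generating function\<close>

definition L_a_denominator :: "real fps" where
  "L_a_denominator = (1 + fps_X) * (1 + fps_X + fps_X ^ 2) * (1 + fps_X ^ 2) *
     (1 - fps_X ^ 3) * (1 - fps_X ^ 5) * (1 - fps_X ^ 6) * (1 - fps_X ^ 7) * (1 - fps_X ^ 8)"

lemma L_a_denominator_nonzero: "L_a_denominator \<noteq> 0"
proof
  assume "L_a_denominator = 0"
  then have "fps_nth L_a_denominator 0 = 0" by simp
  then show False by (simp add: L_a_denominator_def)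
qed

lemma one_minus_X_power_nonzero: "0 < k \<Longrightarrow> 1 - fps_X ^ k \<noteq> (0 :: real fps)"
proof
  assume "0 < k" "1 - fps_X ^ k = (0 :: real fps)"
  with ray_mult[of k] have "fps_X ^ k = (0 :: real fps)" by (metis mult_zero_left)
  then show False by simp
qed

lemma prod_one_minus_X_power_nonzero:
  "0 \<notin> set ks \<Longrightarrow> (\<Prod>k\<leftarrow>ks. 1 - fps_X ^ k) \<noteq> (0 :: real fps)"
  by (induction ks) (auto dest: one_minus_X_power_nonzero)

text \<open>The first three factors of the denominator are what \<open>1 - X^3\<close> and
  \<open>1 - X^4\<close> leave after each loses a factor \<open>1 - X\<close>.\<close>

lemma X_power_3_4_factors:
  "(1 - fps_X ^ 3) * (1 - fps_X ^ 4) =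
    (1 - fps_X) * (1 - fps_X) * ((1 + fps_X) * (1 + fps_X + fps_X ^ 2) * (1 + fps_X ^ 2) :: real fps)"
  by algebra

text \<open>Here \<open>e\<close> stands for those three factors and \<open>r\<close> for the
  factors with exponents 5 to 8. The first identity serves the cone terms, the second the comparison
  with the closed form.\<close>

lemma denominator_products:
  fixes d1 d2 d3 d4 r e :: "'a :: comm_ring_1"
  assumes "d3 * d4 = d1 * d1 * e"
  shows "d1 * (d1 * (d2 * (d2 * (d3 * (d3 * (d3 * (d4 * (d4 * r)))))))) =
      (d1 * (d1 * (d1 * (d1 * (d2 * (d2 * (d3 * d4))))))) * (e * d3 * r)" (is "?l = ?r")
    and "d2 * (d3 * (d3 * (d4 * r))) = (d1 * (d1 * d2)) * (e * d3 * r)" (is "?l' = ?r'")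
proof -
  have "?l = (d1 * d1 * d2 * d2 * d4 * d3 * d3 * r) * (d3 * d4)" by (simp only: ac_simps)
  also have "\<dots> = (d1 * d1 * d2 * d2 * d4 * d3 * d3 * r) * (d1 * d1 * e)" by (simp only: assms)
  also have "\<dots> = ?r" by (simp only: ac_simps)
  finally show "?l = ?r" .
  have "?l' = d2 * d3 * r * (d3 * d4)" by (simp only: ac_simps)
  also have "\<dots> = d2 * d3 * r * (d1 * d1 * e)" by (simp only: assms)
  also have "\<dots> = ?r'" by (simp only: ac_simps)
  finally show "?l' = ?r'" .
qed

lemma L_a_gf_denominator:
  "L_a_denominator * Abs_fps (\<lambda>t. real (L_a t)) = fps_of_list L_a_numerator"
proof -
  let ?L = "Abs_fps (\<lambda>t. real (L_a t))"
  let ?ks = "[1,1,1,1,2,2,3,4] :: nat list"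
  have "(\<Prod>k\<leftarrow>[1,1,2,2,3,3,3,4,4,5,6,7,8]. 1 - fps_X ^ k :: real fps) =
      (\<Prod>k\<leftarrow>?ks. 1 - fps_X ^ k) * L_a_denominator"
    unfolding L_a_denominator_def list.map prod_list.Cons prod_list.Nil mult_1_right power_one_right
    by (rule trans[OF denominator_products(1)[OF X_power_3_4_factors]]) (simp only: mult.assoc)
  then have "(\<Prod>k\<leftarrow>?ks. 1 - fps_X ^ k) * (L_a_denominator * ?L) =
      (\<Prod>k\<leftarrow>?ks. 1 - fps_X ^ k) * fps_of_list L_a_numerator"
    using term_sum_cleared[OF L_a_terms_denominators] fps_of_list_eqI[OF cleared_L_a_terms]
    by (simp only: L_a_gf_terms fps_of_list_fold_dmul mult.assoc)
  moreover have "(\<Prod>k\<leftarrow>?ks. 1 - fps_X ^ k) \<noteq> (0 :: real fps)"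
    by (rule prod_one_minus_X_power_nonzero) simp
  ultimately show ?thesis
    by (metis mult_left_cancel)
qed

lemma fps_of_list_L_a_numerator:
  "fps_of_list L_a_numerator = 12 * fps_X ^ 6 * fps_of_poly C_poly"
proof -
  have "fps_of_poly C_poly = fps_of_list
     [1, 3, 7, 15, 33, 65, 128, 208, 316, 434, 566, 676, 784, 852, 911, 936, 967, 967, 1001, 995, 1000,
      955, 893, 752, 624, 456, 322, 174, 79]"
    by (simp add: C_poly_def fps_of_poly_pCons mult.commute)
  then show ?thesis
    unfolding L_a_numerator_def fps_of_list_shift fps_of_list_scale
    by (simp only: of_int_numeral numeral_fps_const[symmetric] ac_simps)
qed

lemma L_a_0: "L_a 0 = 0"
proof -
  have "fps_nth (Abs_fps (\<lambda>t. real (L_a t))) 0 = 0"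
    unfolding L_a_gf by (simp add: ray_nth)
  then show ?thesis by simp
qed

section \<open>Differences that annihilate the closed form\<close>

definition closed_form :: "nat \<Rightarrow> real" where
  "closed_form t = 1/8 * real t ^ 4 - 3 * real t ^ 3 + a2 t * real t ^ 2 - a1 t * real t
     + a0 t - 72 * real_of_int (S7 t)"

lemma S7_eq: "S7 t = (int t - 1) div 21 + eps t"
proof -
  have "\<lfloor>(real t - 1) / 21\<rfloor> = \<lfloor>real_of_int (int t - 1) / real_of_int 21\<rfloor>" by simp
  also have "\<dots> = (int t - 1) div 21" by (rule floor_divide_of_int_eq)
  finally show ?thesis by (simp add: S7_def)
qed

lemma a2_add_12: "a2 (t + 12) = a2 t"
proof -
  have "(t + 12) mod 6 = t mod 6"
    using mod_mult_self2[of t 6 2] by simp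
  then show ?thesis by (simp add: a2_def)
qed

lemma a1_add_12: "a1 (t + 12) = a1 t"
  by (simp add: a1_def)

lemma a0_add_120: "a0 (t + 120) = a0 t"
proof -
  have "(t + 120) mod 20 = t mod 20"
    using mod_mult_self2[of t 20 6] by simp
  then show ?thesis by (simp add: a0_def)
qed

lemma S7_add_21: "S7 (t + 21) = S7 t + 1"
proof -
  have "(int (t + 21) - 1) div 21 = (int t - 1) div 21 + 1" by simp
  then show ?thesis by (simp add: S7_eq eps_def)
qed

definition delta :: "nat \<Rightarrow> (nat \<Rightarrow> real) \<Rightarrow> nat \<Rightarrow> real" where
  "delta k f t = f (t + k) - f t"

lemma delta_add: "delta k (\<lambda>t. f t + g t) = (\<lambda>t. delta k f t + delta k g t)"
  by (simp add: delta_def fun_eq_iff)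

lemma delta_const: "delta k (\<lambda>t. c) = (\<lambda>t. 0)"
  by (simp add: delta_def fun_eq_iff)

lemma delta_commute: "delta j (delta k f) = delta k (delta j f)"
  by (simp add: delta_def fun_eq_iff add_ac)

text \<open>Five differences kill a polynomial of degree 4. The three steps of 12 kill the quadratic
  and linear terms, whose coefficients have period 12; the step 120 kills \<open>a0\<close>. The
  step 21 makes the \<open>S7\<close> part constant, and any further step kills it. The shift by 1
  restricts attention to positive arguments.\<close>

lemma delta_closed_form:
  "delta 120 (delta 21 (delta 12 (delta 12 (delta 12 (\<lambda>t. closed_form (t + 1)))))) = (\<lambda>t. 0)"
proof -
  define f1 where "f1 t = 1/8 * real (t + 1) ^ 4 - 3 * real (t + 1) ^ 3" for t
  define f2 where "f2 t = a2 (t + 1) * real (t + 1) ^ 2 - a1 (t + 1) * real (t + 1)" for t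
  define f3 where "f3 t = a0 (t + 1)" for t
  define f4 where "f4 t = - 72 * real_of_int (S7 (t + 1))" for t
  have sum: "(\<lambda>t. closed_form (t + 1)) = (\<lambda>t. f1 t + f2 t + f3 t + f4 t)"
    by (simp add: fun_eq_iff closed_form_def f1_def f2_def f3_def f4_def)
  have 1: "delta 120 (delta 21 (delta 12 (delta 12 (delta 12 f1)))) = (\<lambda>t. 0)"
    by (simp add: fun_eq_iff delta_def f1_def power2_eq_square power3_eq_cube power4_eq_xxxx algebra_simps)
  \<comment> \<open>The third difference with step 12 of a quadratic, in the form that unfolding
    \<open>delta\<close> yields; \<open>A\<close> and \<open>B\<close> are the values of
    \<open>a2\<close> and \<open>a1\<close>, constant along these steps.\<close>
  have quadratic: "A * (T + 12 + 12 + 12 + 1)\<^sup>2 - B * (T + 12 + 12 + 12 + 1) -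
      (A * (T + 12 + 12 + 1)\<^sup>2 - B * (T + 12 + 12 + 1)) -
      (A * (T + 12 + 12 + 1)\<^sup>2 - B * (T + 12 + 12 + 1) -
       (A * (T + 12 + 1)\<^sup>2 - B * (T + 12 + 1))) -
      (A * (T + 12 + 12 + 1)\<^sup>2 - B * (T + 12 + 12 + 1) -
       (A * (T + 12 + 1)\<^sup>2 - B * (T + 12 + 1)) -
       (A * (T + 12 + 1)\<^sup>2 - B * (T + 12 + 1) - (A * (T + 1)\<^sup>2 - B * (T + 1)))) = 0"
    for A B T :: real
    by (simp add: power2_eq_square algebra_simps)
  have shift: "a2 (t + 12 + 1) = a2 (t + 1)" "a1 (t + 12 + 1) = a1 (t + 1)" for t
    using a2_add_12[of "t + 1"] a1_add_12[of "t + 1"] by (simp_all only: add.assoc add.commute[of 12 1])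
  have "delta 12 (delta 12 (delta 12 f2)) t = 0" for t
    unfolding delta_def f2_def shift of_nat_add of_nat_numeral of_nat_1 by (rule quadratic)
  then have "delta 12 (delta 12 (delta 12 f2)) = (\<lambda>t. 0)"
    by (simp add: fun_eq_iff)
  then have 2: "delta 120 (delta 21 (delta 12 (delta 12 (delta 12 f2)))) = (\<lambda>t. 0)"
    by (simp add: delta_const)
  have "delta 120 f3 = (\<lambda>t. 0)"
    using a0_add_120[of "Suc _"] by (simp add: fun_eq_iff delta_def f3_def)
  then have 3: "delta 120 (delta 21 (delta 12 (delta 12 (delta 12 f3)))) = (\<lambda>t. 0)"
    by (simp add: delta_commute[of 120] delta_const)
  have "delta 21 f4 = (\<lambda>t. - 72)"
    using S7_add_21[of "Suc _"] by (simp add: fun_eq_iff delta_def f4_def)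
  then have 4: "delta 120 (delta 21 (delta 12 (delta 12 (delta 12 f4)))) = (\<lambda>t. 0)"
    by (simp add: delta_commute[of 21] delta_const)
  show ?thesis
    unfolding sum delta_add 1 2 3 4 by simp
qed

text \<open>Multiplication by \<open>1 - X^k\<close> acts on coefficients as a difference with step
  \<open>k\<close>. The offset \<open>N\<close> marks where the description by \<open>f\<close>
  begins, and it grows by \<open>k\<close> each time.\<close>

lemma delta_nth:
  assumes "\<And>n. fps_nth F (n + N) = f n"
  shows "fps_nth ((1 - fps_X ^ k) * F) (n + (N + k)) = delta k f n"
  using assms[of n] assms[of "n + k"]
  by (simp add: delta_def left_diff_distrib fps_X_power_mult_nth add_ac)

lemma fps_mult_nth_cong:
  "(\<And>m. m \<le> n \<Longrightarrow> fps_nth F m = fps_nth G m) \<Longrightarrow> fps_nth (H * F) n = fps_nth (H * G) n"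
  by (simp add: fps_mult_nth)

text \<open>The values of the closed form at \<open>0 < t < 178\<close>. From there on the differences with steps
  120, 21, 12, 12, 12, of total length 177, involve positive arguments only. The entry at 0 is a dummy.\<close>

definition initial_values :: "int list" where
  "initial_values =
     [0, 0, 0, 0, 0, 0, 12, 12, 24, 72, 156, 240, 552, 600, 1020, 1548, 2004, 2568, 4008, 4644, 6264,
      8136, 10152, 12168, 16284, 18372, 22992, 27972, 32736, 37896, 47352, 52332, 62004, 72288, 82572,
      93108, 110280, 120492, 138420, 157428, 175248, 193824, 223428, 241500, 270744, 301716, 331464,
      362076, 406956, 436668, 482412, 529596, 574404, 620976, 687576, 732960, 798660, 867204, 933084,
      1000548, 1093044, 1158708, 1251456, 1346940, 1437888, 1531716, 1657740, 1749408, 1873560, 2002140,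
      2126004, 2252388, 2417160, 2540556, 2705148, 2873664, 3034980, 3200868, 3413784, 3576072, 3786072,
      4002012, 4210680, 4423164, 4690452, 4898760, 5164608, 5436360, 5697744, 5965212, 6297960, 6560280,
      6888420, 7224516, 7550028, 7881336, 8286168, 8611248, 9013740, 9423864, 9819984, 10224132,
      10714404, 11111568, 11595432, 12089664, 12569352, 13056672, 13639692, 14119056, 14698188,
      15287184, 15857964, 16438932, 17129784, 17701716, 18384036, 19079352, 19755660, 20442048,
      21249012, 21924744, 22725984, 23539536, 24329904, 25133304, 26072868, 26864676, 27793368,
      28737936, 29658852, 30591864, 31673496, 32593656, 33667404, 34756452, 35816628, 36892824,
      38134632, 39196428, 40424880, 41672160, 42890136, 44123232, 45535620, 46752876, 48154896,
      49575348, 50960880, 52365600, 53968296, 55355628, 56941908, 58550472, 60123828, 61715292,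
      63519384, 65091876, 66883116, 68696172, 70467792, 72261840, 74289252, 76062564, 78070248,
      80104212, 82095768, 84109140, 86371572, 88362372, 90609036, 92880900, 95104380, 97353960,
      99874920, 102100416, 104598084, 107126028]"

text \<open>At 0 the closed form has the value 948, not the count 0, so the constant term is set
  separately.\<close>

definition closed_form_gf :: "real fps" where
  "closed_form_gf = Abs_fps (\<lambda>t. if t > 0 then closed_form t else 0)"

lemma closed_form_initial:
  "map closed_form (1 # [2..<178]) = map of_int (tl initial_values)"
  by (simp add: closed_form_def S7_eq eps_def a2_def a1_def a0_def a0_table_def initial_values_def)

lemma closed_form_gf_nth_initial:
  assumes "n < 178"
  shows "fps_nth closed_form_gf n = fps_nth (fps_of_list initial_values) n"
proof -
  have len: "length initial_values = 178" by (simp add: initial_values_def)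
  show ?thesis
  proof (cases n)
    case 0
    then show ?thesis by (simp add: closed_form_gf_def fps_of_list_nth len) (simp add: initial_values_def)
  next
    case (Suc m)
    then have "closed_form n = map closed_form (1 # [2..<178]) ! m"
      using assms by (cases m) (simp_all add: nth_upt numeral_2_eq_2)
    also have "\<dots> = of_int (initial_values ! n)"
      unfolding closed_form_initial using Suc assms len by (simp add: nth_tl)
    finally show ?thesis
      using Suc assms by (simp add: closed_form_gf_def fps_of_list_nth len)
  qed
qed

lemma fps_of_list_nth_take:
  "n < k \<Longrightarrow> fps_nth (fps_of_list (take k xs)) n = fps_nth (fps_of_list xs) n"
  by (simp add: fps_of_list_nth)

text \<open>Only the first 178 coefficients of this product are meaningful: the later ones result
  from cutting the series off after the initial values, while those of the true product
  vanish.\<close>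

definition closed_form_numerator :: "int list" where
  "closed_form_numerator = take 178 (fold dmul [120,21,12,12,12] initial_values)"

lemma closed_form_gf_denominator:
  "(\<Prod>k\<leftarrow>[120,21,12,12,12]. 1 - fps_X ^ k) * closed_form_gf = fps_of_list closed_form_numerator"
proof (rule fps_ext)
  fix n
  show "fps_nth ((\<Prod>k\<leftarrow>[120,21,12,12,12]. 1 - fps_X ^ k) * closed_form_gf) n =
      fps_nth (fps_of_list closed_form_numerator) n"
  proof (cases "n < 178")
    case True
    have "fps_nth ((\<Prod>k\<leftarrow>[120,21,12,12,12]. 1 - fps_X ^ k) * closed_form_gf) n =
        fps_nth (fps_of_list (fold dmul [120,21,12,12,12] initial_values)) n"
      unfolding fps_of_list_fold_dmul by (rule fps_mult_nth_cong, rule closed_form_gf_nth_initial, use True in simp)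
    also have "\<dots> = fps_nth (fps_of_list closed_form_numerator) n"
      unfolding closed_form_numerator_def by (rule fps_of_list_nth_take[OF True, symmetric])
    finally show ?thesis .
  next
    case False
    \<comment> \<open>The summand 1 is the least positive argument; the others are the step lengths,
      so the differences at \<open>m\<close> only see the closed form at positive arguments.\<close>
    then obtain m where n: "n = m + (1 + 12 + 12 + 12 + 21 + 120)"
      using le_Suc_ex[of 178 n] by (auto simp: add.commute)
    have "fps_nth closed_form_gf (m + 1) = closed_form (m + 1)" for m
      by (simp add: closed_form_gf_def)
    note delta_nth[OF delta_nth[OF delta_nth[OF delta_nth[OF delta_nth[OF this]]]], of 120 21 12 12 12 m]
    moreover have "(\<Prod>k\<leftarrow>[120,21,12,12,12]. 1 - fps_X ^ k) * closed_form_gf =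
        (1 - fps_X ^ 120) * ((1 - fps_X ^ 21) *
        ((1 - fps_X ^ 12) * ((1 - fps_X ^ 12) * ((1 - fps_X ^ 12) * closed_form_gf))))"
      by (simp only: list.map prod_list.Cons prod_list.Nil mult_1_right mult.assoc)
    moreover have "fps_nth (fps_of_list closed_form_numerator) n = 0"
      using False unfolding fps_of_list_nth closed_form_numerator_def length_take by simp
    ultimately show ?thesis
      unfolding n delta_closed_form by (simp only:)
  qed
qed

text \<open>Equality of the two rational series by cross-multiplication. The factors for
  \<open>[1,1,2]\<close> complete the denominator in the theorem to the product for
  \<open>[2,3,3,4,5,6,7,8]\<close>.\<close>

lemma closed_form_numerator_check:
  "list_all ((=) 0) (list_sub (fold dmul [2,3,3,4,5,6,7,8] closed_form_numerator)
     (fold dmul [1,1,2,120,21,12,12,12] L_a_numerator))"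
  by code_simp

lemma closed_form_gf_eq: "closed_form_gf = Abs_fps (\<lambda>t. real (L_a t))"
proof -
  let ?P = "\<lambda>ks. \<Prod>k\<leftarrow>ks. 1 - fps_X ^ k :: real fps"
  let ?L = "Abs_fps (\<lambda>t. real (L_a t))"
  have "?P [2,3,3,4,5,6,7,8] = ?P [1,1,2] * L_a_denominator"
    unfolding L_a_denominator_def list.map prod_list.Cons prod_list.Nil mult_1_right power_one_right
    by (rule trans[OF denominator_products(2)[OF X_power_3_4_factors]]) (simp only: mult.assoc)
  moreover have "?P [2,3,3,4,5,6,7,8] * (?P [120,21,12,12,12] * closed_form_gf) =
      ?P [1,1,2,120,21,12,12,12] * fps_of_list L_a_numerator"
    using fps_of_list_eqI[OF closed_form_numerator_check]
    unfolding fps_of_list_fold_dmul closed_form_gf_denominator .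
  moreover have "?P [1,1,2,120,21,12,12,12] = ?P [1,1,2] * ?P [120,21,12,12,12]"
    by (simp add: mult.assoc)
  ultimately have "(?P [1,1,2] * L_a_denominator * ?P [120,21,12,12,12]) * closed_form_gf =
      (?P [1,1,2] * L_a_denominator * ?P [120,21,12,12,12]) * ?L"
    unfolding L_a_gf_denominator[symmetric] by (simp only: ac_simps)
  moreover note L_a_denominator_nonzero
  moreover have "?P [1,1,2] \<noteq> 0" "?P [120,21,12,12,12] \<noteq> 0"
    by (rule prod_one_minus_X_power_nonzero, simp)+
  ultimately show ?thesis
    by (metis mult_left_cancel no_zero_divisors)
qed

lemma L_a_closed_form:
  assumes "0 < t"
  shows "real (L_a t) = closed_form t"
proof -
  have "fps_nth closed_form_gf t = fps_nth (Abs_fps (\<lambda>t. real (L_a t))) t"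
    by (simp only: closed_form_gf_eq)
  with assms show ?thesis by (simp add: closed_form_gf_def)
qed

section \<open>Period and principal constituent\<close>

text \<open>The deviation of \<open>S7\<close> from its linear part: it has period 21 and determines \<open>t\<close> modulo 21.\<close>

definition S7_offset :: "nat \<Rightarrow> real" where
  "S7_offset t = real_of_int (S7 t) - real t / 21"

text \<open>Splitting \<open>S7 t\<close> into \<open>t / 21\<close> and its periodic offset moves
  \<open>- 72 / 21 = - 24/7\<close> into the linear coefficient.\<close>

definition constituent :: "nat \<Rightarrow> real poly" where
  "constituent r = [:a0 r - 72 * S7_offset r, - a1 r - 24/7, a2 r, - 3, 1/8:]"

lemma S7_offset_mod: "S7_offset (t mod 840) = S7_offset t"
proof -
  have "S7_offset (s + 21 * n) = S7_offset s" for s n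
  proof (induction n)
    case (Suc n)
    have "S7_offset (s + 21 * n + 21) = S7_offset (s + 21 * n)"
      by (simp only: S7_offset_def S7_add_21) (simp add: field_simps)
    with Suc show ?case by (simp add: add_ac)
  qed simp
  from this[of "t mod 840" "40 * (t div 840)"] show ?thesis
    by (simp add: mult.assoc[symmetric])
qed

text \<open>840 is the least common multiple of 120 and 21, and the periods of \<open>a1\<close> and
  \<open>a2\<close> divide 120.\<close>

lemma constituent_mod: "constituent (t mod 840) = constituent t"
  unfolding constituent_def S7_offset_mod
  by (simp add: a0_def a1_def a2_def mod_mod_cancel)

lemma closed_form_eq_poly: "closed_form t = poly (constituent t) (real t)"
  by (simp add: closed_form_def constituent_def S7_offset_def power2_eq_square power3_eq_cube power4_eq_xxxx
      field_simps)

lemma has_constituents_840: "has_constituents (\<lambda>t. real (L_a t)) 840 constituent"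
  by (simp add: has_constituents_def L_a_closed_form constituent_mod closed_form_eq_poly)

section \<open>Uniqueness of constituents and minimality of the period\<close>

lemma poly_eqI_residue_class:
  assumes "0 < m" "\<And>k. 0 < k \<Longrightarrow> poly p (real (m * k + r)) = poly q (real (m * k + r))"
  shows "p = q"
proof (rule ccontr)
  assume "p \<noteq> q"
  then have "finite {x. poly (p - q) x = 0}" by (intro poly_roots_finite) simp
  moreover have "(\<lambda>k. real (m * k + r)) ` {0<..} \<subseteq> {x. poly (p - q) x = 0}"
    using assms(2) by auto
  moreover have "inj_on (\<lambda>k. real (m * k + r)) {0<..}"
    using assms(1) by (auto simp: inj_on_def)
  ultimately have "finite {0 :: nat<..}"
    by (metis finite_imageD finite_subset)
  then show False using infinite_Ioi by blast
qed

text \<open>Along the arithmetic progression from \<open>r\<close> with step \<open>840 * p\<close>,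
  both polynomials compute \<open>L_a\<close>, so they agree at infinitely many points.\<close>

lemma has_constituents_unique:
  assumes c: "has_constituents (\<lambda>t. real (L_a t)) p c"
  shows "c (r mod p) = constituent r"
proof (rule poly_eqI_residue_class[where m = "840 * p" and r = r])
  show "0 < 840 * p" using c by (simp add: has_constituents_def)
next
  fix k :: nat assume "0 < k"
  moreover have "0 < p" using c by (simp add: has_constituents_def)
  ultimately have "0 < 840 * p * k + r" by simp
  moreover have "(840 * p * k + r) mod p = r mod p" by (simp add: mult.assoc mult.left_commute[of _ p])
  moreover have "(840 * p * k + r) mod 840 = r mod 840" by (simp add: mult.assoc)
  ultimately show "poly (c (r mod p)) (real (840 * p * k + r)) = poly (constituent r) (real (840 * p * k + r))"
    using c has_constituents_840 unfolding has_constituents_def by (metis constituent_mod)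
qed

lemma a1_eq_a1_0: "a1 t = a1 0 \<Longrightarrow> 12 dvd t"
  by (auto simp: a1_def split: if_splits)

text \<open>948 is the constant coefficient of \<open>constituent 0\<close>; the arguments
  \<open>12 * j\<close> are the classes that the linear coefficient cannot tell from 0.\<close>

definition separated_from_0 :: "nat \<Rightarrow> bool" where
  "separated_from_0 j \<longleftrightarrow> a0 (12 * j) - 72 * S7_offset (12 * j) \<noteq> 948"

lemma list_all_separated_from_0: "list_all separated_from_0 (1 # [2..<70])"
  by (simp add: separated_from_0_def S7_offset_def S7_eq eps_def a0_def a0_table_def)

text \<open>Equal linear coefficients force \<open>12 dvd t\<close>. Among the multiples of 12 below
  840, the constant coefficient then rules out the 69 nonzero ones.\<close>

lemma constituent_eq_0:
  assumes "constituent t = constituent 0"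
  shows "840 dvd t"
proof (rule ccontr)
  assume not: "\<not> 840 dvd t"
  have "constituent (t mod 840) = constituent 0" by (simp add: constituent_mod assms)
  then have eq: "a1 (t mod 840) = a1 0" "a0 (t mod 840) - 72 * S7_offset (t mod 840) = 948"
    by (simp_all add: constituent_def a0_def a0_table_def S7_offset_def S7_eq eps_def)
  from eq(1) obtain j where j: "t mod 840 = 12 * j" by (blast dest: a1_eq_a1_0 elim: dvdE)
  have "t mod 840 < 840" "t mod 840 \<noteq> 0" using not by (auto simp: dvd_eq_mod_eq_0)
  with j have "j = 1 \<or> 2 \<le> j \<and> j < 70" by linarith
  then have "j \<in> set (1 # [2..<70])"
    unfolding list.set set_upt insert_iff atLeastLessThan_iff .
  then have "separated_from_0 j"
    using list_all_separated_from_0 unfolding list_all_iff by blast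
  with eq(2) j show False by (simp add: separated_from_0_def)
qed

text \<open>For any admissible \<open>p\<close>, the arguments \<open>p\<close> and 0 lie in the
  same class modulo \<open>p\<close>, so \<open>constituent p\<close> and
  \<open>constituent 0\<close> coincide and \<open>840 dvd p\<close>.\<close>

lemma quasi_period_L_a: "quasi_period (\<lambda>t. real (L_a t)) = 840"
  unfolding quasi_period_def
proof (rule Least_equality)
  show "\<exists>c. has_constituents (\<lambda>t. real (L_a t)) 840 c"
    using has_constituents_840 by blast
next
  fix p assume "\<exists>c. has_constituents (\<lambda>t. real (L_a t)) p c"
  then obtain c where c: "has_constituents (\<lambda>t. real (L_a t)) p c" by blast
  have "constituent p = constituent 0"
    using has_constituents_unique[OF c, of p] has_constituents_unique[OF c, of 0] by simp
  then have "840 dvd p" by (rule constituent_eq_0)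
  moreover have "0 < p" using c by (simp add: has_constituents_def)
  ultimately show "840 \<le> p" by (rule dvd_imp_le)
qed

lemma principal_constituent_L_a:
  "principal_constituent (\<lambda>t. real (L_a t)) = [:948, - 9192/35, 151/4, - 3, 1/8:]"
proof -
  have "principal_constituent (\<lambda>t. real (L_a t)) = constituent 0"
    unfolding principal_constituent_def quasi_period_L_a
  proof (rule the_equality)
    show "\<exists>c. has_constituents (\<lambda>t. real (L_a t)) 840 c \<and> constituent 0 = c 0"
      using has_constituents_840 by blast
  next
    fix q assume "\<exists>c. has_constituents (\<lambda>t. real (L_a t)) 840 c \<and> q = c 0"
    then show "q = constituent 0"
      using has_constituents_unique[of 840 _ 0] by auto
  qed
  \<comment> \<open>Since \<open>S7 0 = - 1\<close>, the constant coefficient is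
    \<open>876 + 72 = 948\<close>; the linear one is
    \<open>- 1296/5 - 24/7 = - 9192/35\<close>.\<close>
  also have "\<dots> = [:948, - 9192/35, 151/4, - 3, 1/8:]"
    by (simp add: constituent_def a0_def a0_table_def a1_def a2_def S7_offset_def S7_eq eps_def)
  finally show ?thesis .
qed

theorem mainTheorem6:
  shows "Abs_fps (\<lambda>t. if t > 0 then real (L_a t) else 0) =
           12 * fps_X ^ 6 * fps_of_poly C_poly /
           ((1 + fps_X) * (1 + fps_X + fps_X ^ 2) * (1 + fps_X ^ 2) *
            (1 - fps_X ^ 3) * (1 - fps_X ^ 5) * (1 - fps_X ^ 6) *
            (1 - fps_X ^ 7) * (1 - fps_X ^ 8)) \<and>
         (\<forall>t\<ge>1. real (L_a t) =
           1/8 * real t ^ 4 - 3 * real t ^ 3 + a2 t * real t ^ 2 - a1 t * real t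
           + a0 t - 72 * real_of_int (S7 t)) \<and>
         quasipolynomial (\<lambda>t. real (L_a t)) \<and>
         quasi_period (\<lambda>t. real (L_a t)) = 840 \<and>
         principal_constituent (\<lambda>t. real (L_a t)) = [:948, - 9192/35, 151/4, - 3, 1/8:]"
proof (intro conjI)
  \<comment> \<open>The series in the theorem starts at \<open>t = 1\<close>; as
    \<open>L_a 0 = 0\<close>, it is the full generating function.\<close>
  have "(\<lambda>t. if t > 0 then real (L_a t) else 0) = (\<lambda>t. real (L_a t))"
    by (auto simp: fun_eq_iff L_a_0)
  moreover have "Abs_fps (\<lambda>t. real (L_a t)) = fps_of_list L_a_numerator / L_a_denominator"
    unfolding L_a_gf_denominator[symmetric]
    by (rule nonzero_mult_div_cancel_left[symmetric]) (rule L_a_denominator_nonzero)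
  ultimately show "Abs_fps (\<lambda>t. if t > 0 then real (L_a t) else 0) =
           12 * fps_X ^ 6 * fps_of_poly C_poly /
           ((1 + fps_X) * (1 + fps_X + fps_X ^ 2) * (1 + fps_X ^ 2) *
            (1 - fps_X ^ 3) * (1 - fps_X ^ 5) * (1 - fps_X ^ 6) *
            (1 - fps_X ^ 7) * (1 - fps_X ^ 8))"
    by (simp only: fps_of_list_L_a_numerator L_a_denominator_def)
  show "\<forall>t\<ge>1. real (L_a t) = 1/8 * real t ^ 4 - 3 * real t ^ 3 + a2 t * real t ^ 2 - a1 t * real t
           + a0 t - 72 * real_of_int (S7 t)"
    using L_a_closed_form by (auto simp: closed_form_def)
  show "quasipolynomial (\<lambda>t. real (L_a t))"
    unfolding quasipolynomial_def using has_constituents_840 by blast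
qed (fact quasi_period_L_a principal_constituent_L_a)+

end
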